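(* Let $F$ be a punctured surface and suppose that $\mu:\Delta\to\mathbb R$ is the measure of a decorated measured lamination with respect to some ideal triangulation $\Delta$ of $F$, and that $\mu$ satisfies the tropical triangle inequalities on each triangle complementary to $\Delta$, i.e. for each such triangle with sides $a,b,c$, one has $\mu(a)\le\max\{\mu(b),\mu(c)\}$, $\mu(b)\le\max\{\mu(a),\mu(c)\}$ and $\mu(c)\le\max\{\mu(a),\mu(b)\}$. Then each leaf of the corresponding lamination $\mathcal L=c_M(\mu)$ is a simple closed curve.
   Context: $F$ is an oriented surface of genus $g$ with $s\ge1$ punctures and negative Euler characteristic. An ideal triangulation $\Delta$ is (the isotopy class of) a collection of arcs joining punctures which decomposes $F$ into triangles with vertices at the punctures. A decorated measured lamination is a compactly supported measured lamination together with a real weight (decoration) for the puncture-parallel (collar) curve at each puncture; a positive decoration is the transverse measure of a band of leaves parallel to the collar curve, a negative one is regarded as a deficit of such leaves. Measures $\mu\in\mathbb R^\Delta$ give global coordinates $c_M:\mathbb R^\Delta\to\widetilde{\mathcal{ML}}_0(F)$ on the space of decorated measured laminations as follows: in each triangle with sides of measures $x,y,z$, the corner between the sides $x$ and $y$ carries a (possibly negative) band of width $(x+y-z)/2$ of arcs parallel to that corner; the minimum of the corner widths around each puncture is the decoration of the puncture, and subtracting this minimum from all the corner widths at each puncture yields nonnegative widths which glue up to the compactly supported measured lamination. *)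

theory Defs
  imports "HOL-Analysis.Analysis" "HOL-Complex_Analysis.Winding_Numbers"
begin

section \<open>Punctured oriented surfaces\<close>

definition simple_closed_curve :: "'a::topological_space set \<Rightarrow> bool" where
  "simple_closed_curve c \<longleftrightarrow>
     (\<exists>\<gamma>. simple_path \<gamma> \<and> pathfinish \<gamma> = pathstart \<gamma> \<and> path_image \<gamma> = c)"

text \<open>For a local homeomorphism of the plane, the winding number of the image of a small
  counterclockwise circle is \<open>1\<close> or \<open>-1\<close> according to the local degree.\<close>

definition orientation_preserving_on :: "complex set \<Rightarrow> (complex \<Rightarrow> complex) \<Rightarrow> bool" where
  "orientation_preserving_on W \<psi> \<longleftrightarrow>
     (\<forall>z\<in>W. \<exists>r>0. cball z r \<subseteq> W \<and> winding_number (\<psi> \<circ> circlepath z r) (\<psi> z) = 1)"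

definition oriented_atlas ::
  "'a::topological_space set \<Rightarrow> ('a set \<times> ('a \<Rightarrow> complex)) set \<Rightarrow> bool" where
  "oriented_atlas S \<A> \<longleftrightarrow>
     \<Union>(fst ` \<A>) = S \<and>
     (\<forall>(U, f)\<in>\<A>. openin (top_of_set S) U \<and> open (f ` U) \<and> (\<exists>g. homeomorphism U (f ` U) f g)) \<and>
     (\<forall>(U, f)\<in>\<A>. \<forall>(V, h)\<in>\<A>. orientation_preserving_on (f ` (U \<inter> V)) (h \<circ> inv_into U f))"

definition closed_oriented_surface ::
  "'a::t2_space set \<Rightarrow> ('a set \<times> ('a \<Rightarrow> complex)) set \<Rightarrow> bool" where
  "closed_oriented_surface S \<A> \<longleftrightarrow>
     S \<noteq> {} \<and> compact S \<and> connected S \<and> oriented_atlas S \<A>"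

text \<open>The genus is the maximal number of disjoint simple closed curves that together do not
  separate the surface.\<close>

definition nonseparating_system :: "'a::topological_space set \<Rightarrow> 'a set set \<Rightarrow> bool" where
  "nonseparating_system S \<C> \<longleftrightarrow>
     finite \<C> \<and> pairwise disjnt \<C> \<and> (\<forall>c\<in>\<C>. simple_closed_curve c \<and> c \<subseteq> S) \<and>
     connected (S - \<Union>\<C>)"

definition has_genus :: "'a::topological_space set \<Rightarrow> nat \<Rightarrow> bool" where
  "has_genus S g \<longleftrightarrow>
     (\<exists>\<C>. nonseparating_system S \<C> \<and> card \<C> = g) \<and>
     (\<forall>\<C>. nonseparating_system S \<C> \<longrightarrow> card \<C> \<le> g)"

text \<open>The surface \<open>F\<close> is \<open>S - P\<close>, where \<open>S\<close> is closed and \<open>P\<close> is the set of punctures.\<close>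

definition punctured_surface ::
  "'a::t2_space set \<Rightarrow> ('a set \<times> ('a \<Rightarrow> complex)) set \<Rightarrow> 'a set \<Rightarrow> nat \<Rightarrow> nat \<Rightarrow> bool" where
  "punctured_surface S \<A> P g s \<longleftrightarrow>
     closed_oriented_surface S \<A> \<and> has_genus S g \<and>
     P \<subseteq> S \<and> finite P \<and> card P = s \<and> s \<ge> 1 \<and> 2 - 2 * int g - int s < 0"


section \<open>Ideal triangulations\<close>

text \<open>The model triangle. Vertices are indexed modulo 3; side \<open>k\<close> is the open side opposite to
  vertex \<open>k\<close>, so that the corner at vertex \<open>k\<close> lies between the sides \<open>k + 1\<close> and \<open>k + 2\<close>.\<close>

definition vtx :: "nat \<Rightarrow> complex" where
  "vtx k = cis (2 * pi * real k / 3)"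

definition model_triangle :: "complex set" where
  "model_triangle = convex hull {vtx 0, vtx 1, vtx 2}"

definition side :: "nat \<Rightarrow> complex set" where
  "side k = open_segment (vtx (k + 1)) (vtx (k + 2))"

definition triangles :: "'a::topological_space set \<Rightarrow> 'a set \<Rightarrow> 'a set set \<Rightarrow> 'a set set" where
  "triangles S P \<Delta> = components (S - P - \<Union>\<Delta>)"

text \<open>\<open>\<Delta>\<close> is a representative of the isotopy class of the triangulation. Its members are arcs
  without their end points (which may coincide). For every complementary region \<open>C\<close> the
  characteristic map \<open>\<phi> C\<close> exhibits \<open>C\<close> as a triangle; two of its sides may be
  the same arc. The last clause, that every arc has a triangle on each of its two sides, is
  automatic in a surface without boundary.\<close>

definition ideal_triangulation ::
  "'a::t2_space set \<Rightarrow> 'a set \<Rightarrow> 'a set set \<Rightarrow> ('a set \<Rightarrow> complex \<Rightarrow> 'a) \<Rightarrow> bool" where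
  "ideal_triangulation S P \<Delta> \<phi> \<longleftrightarrow>
     finite \<Delta> \<and> pairwise disjnt \<Delta> \<and>
     (\<forall>e\<in>\<Delta>. e \<subseteq> S - P \<and>
        (\<exists>\<gamma>. simple_path \<gamma> \<and> pathstart \<gamma> \<in> P \<and> pathfinish \<gamma> \<in> P \<and> e = \<gamma> ` {0<..<1})) \<and>
     (\<forall>C\<in>triangles S P \<Delta>.
        continuous_on model_triangle (\<phi> C) \<and>
        inj_on (\<phi> C) (interior model_triangle) \<and> \<phi> C ` interior model_triangle = C \<and>
        (\<forall>k<3. \<phi> C (vtx k) \<in> P \<and> inj_on (\<phi> C) (side k) \<and> \<phi> C ` side k \<in> \<Delta>)) \<and>
     (\<forall>e\<in>\<Delta>. card {(C, k). C \<in> triangles S P \<Delta> \<and> k < 3 \<and> \<phi> C ` side k = e} = 2)"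


section \<open>Measured laminations\<close>

text \<open>A lamination of \<open>F\<close> is given by its set of leaves \<open>\<L>\<close>, with support \<open>\<Union>\<L>\<close>. In a flow box the
  leaves are unions of horizontal plaques. Since a leaf contains only countably many plaques of a
  box, a path inside a leaf never moves from one plaque to another, so that path connectedness
  of a leaf is connectedness in its intrinsic one-dimensional topology.\<close>

definition flow_box ::
  "'a::topological_space set \<Rightarrow> 'a set set \<Rightarrow> 'a set \<Rightarrow> ('a \<Rightarrow> real \<times> real) \<Rightarrow> bool" where
  "flow_box F \<L> U f \<longleftrightarrow>
     openin (top_of_set F) U \<and> (\<exists>g. homeomorphism U ({0<..<1} \<times> {0<..<1}) f g) \<and>
     (\<forall>x\<in>U \<inter> \<Union>\<L>. \<exists>l\<in>\<L>. {y\<in>U. snd (f y) = snd (f x)} \<subseteq> l) \<and>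
     (\<forall>l\<in>\<L>. countable ((snd \<circ> f) ` (l \<inter> U)))"

definition lamination :: "'a::topological_space set \<Rightarrow> 'a set set \<Rightarrow> bool" where
  "lamination F \<L> \<longleftrightarrow>
     pairwise disjnt \<L> \<and> (\<forall>l\<in>\<L>. l \<noteq> {} \<and> path_connected l) \<and>
     closedin (top_of_set F) (\<Union>\<L>) \<and>
     (\<forall>x\<in>\<Union>\<L>. \<exists>U f. flow_box F \<L> U f \<and> x \<in> U)"

definition transversal :: "'a::topological_space set \<Rightarrow> 'a set set \<Rightarrow> 'a set \<Rightarrow> bool" where
  "transversal F \<L> \<tau> \<longleftrightarrow>
     \<tau> \<subseteq> F \<and> \<tau> homeomorphic {0<..<1::real} \<and>
     (\<forall>x\<in>\<tau> \<inter> \<Union>\<L>. \<exists>U f. flow_box F \<L> U f \<and> x \<in> U \<and> inj_on (snd \<circ> f) (\<tau> \<inter> U))"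

text \<open>A transverse measure is a single set function, which is relevant only on Borel subsets
  of transversals. It has full support and is invariant under sliding sets along leaves.\<close>

definition transverse_measure ::
  "'a::topological_space set \<Rightarrow> 'a set set \<Rightarrow> ('a set \<Rightarrow> ennreal) \<Rightarrow> bool" where
  "transverse_measure F \<L> \<nu> \<longleftrightarrow>
     (\<forall>\<tau>. transversal F \<L> \<tau> \<longrightarrow>
        measure_space \<tau> (sets (restrict_space borel \<tau>)) \<nu> \<and>
        (\<forall>K\<subseteq>\<tau>. compact K \<longrightarrow> \<nu> K < \<infinity>) \<and>
        (\<forall>V. openin (top_of_set \<tau>) V \<longrightarrow> (\<nu> V = 0 \<longleftrightarrow> V \<inter> \<Union>\<L> = {}))) \<and>
     (\<forall>\<tau> \<tau>' A B H.
        transversal F \<L> \<tau> \<and> A \<in> sets (restrict_space borel \<tau>) \<and> A \<subseteq> \<Union>\<L> \<and>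
        transversal F \<L> \<tau>' \<and> B \<in> sets (restrict_space borel \<tau>') \<and> B \<subseteq> \<Union>\<L> \<and>
        continuous_on (A \<times> {0..1::real}) H \<and>
        (\<forall>x\<in>A. H (x, 0) = x \<and> (\<exists>l\<in>\<L>. H ` ({x} \<times> {0..1}) \<subseteq> l)) \<and>
        bij_betw (\<lambda>x. H (x, 1)) A B
        \<longrightarrow> \<nu> A = \<nu> B)"

definition measured_lamination ::
  "'a::topological_space set \<Rightarrow> 'a set set \<Rightarrow> ('a set \<Rightarrow> ennreal) \<Rightarrow> bool" where
  "measured_lamination F \<L> \<nu> \<longleftrightarrow> lamination F \<L> \<and> transverse_measure F \<L> \<nu>"


section \<open>The decorated measured lamination with given measures\<close>

definition corner_width ::
  "('a set \<Rightarrow> complex \<Rightarrow> 'a) \<Rightarrow> ('a set \<Rightarrow> real) \<Rightarrow> 'a set \<Rightarrow> nat \<Rightarrow> real" where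
  "corner_width \<phi> \<mu> C k =
     (\<mu> (\<phi> C ` side (k + 1)) + \<mu> (\<phi> C ` side (k + 2)) - \<mu> (\<phi> C ` side k)) / 2"

definition decoration ::
  "'a::topological_space set \<Rightarrow> 'a set \<Rightarrow> 'a set set \<Rightarrow> ('a set \<Rightarrow> complex \<Rightarrow> 'a) \<Rightarrow>
   ('a set \<Rightarrow> real) \<Rightarrow> 'a \<Rightarrow> real" where
  "decoration S P \<Delta> \<phi> \<mu> p =
     Min {corner_width \<phi> \<mu> C k | C k. C \<in> triangles S P \<Delta> \<and> k < 3 \<and> \<phi> C (vtx k) = p}"

text \<open>A band of pairwise disjoint arcs around the corner \<open>k\<close>, each lying (via the characteristic
  map \<open>\<psi>\<close> of the triangle) in a leaf. The arcs are indexed by an arbitrary compact set of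
  reals, such as a point, an interval or a Cantor set.\<close>

definition corner_band ::
  "'a set set \<Rightarrow> (complex \<Rightarrow> 'a) \<Rightarrow> nat \<Rightarrow> real set \<Rightarrow> (real \<times> real \<Rightarrow> complex) \<Rightarrow> bool" where
  "corner_band \<L> \<psi> k K \<Psi> \<longleftrightarrow>
     compact K \<and> continuous_on (K \<times> {0..1}) \<Psi> \<and> inj_on \<Psi> (K \<times> {0..1}) \<and>
     (\<forall>y\<in>K. \<Psi> (y, 0) \<in> side (k + 1) \<and> \<Psi> (y, 1) \<in> side (k + 2) \<and>
        (\<forall>t\<in>{0<..<1}. \<Psi> (y, t) \<in> interior model_triangle) \<and>
        (\<exists>l\<in>\<L>. \<psi> ` \<Psi> ` ({y} \<times> {0..1}) \<subseteq> l))"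

text \<open>The decorated measured lamination given by \<open>(\<L>, \<nu>)\<close> and the decoration \<open>d\<close> represents \<open>c_M(\<mu>)\<close>:
  \<open>\<L>\<close> has compact support in \<open>S - P\<close>, is transverse to \<open>\<Delta>\<close>, and consists in each triangle of
  three bands of corner arcs whose transverse measures are the corner widths
  diminished by the decorations of the punctures. As the lamination is only
  determined up to isotopy, this is a relation. No leaf is null-homotopic, since it
  meets each triangle in corner arcs only, and none is puncture parallel, since at each puncture some
  corner has reduced width zero.\<close>

definition represents_c_M ::
  "'a::t2_space set \<Rightarrow> 'a set \<Rightarrow> 'a set set \<Rightarrow> ('a set \<Rightarrow> complex \<Rightarrow> 'a) \<Rightarrow> ('a set \<Rightarrow> real) \<Rightarrow>
   'a set set \<Rightarrow> ('a set \<Rightarrow> ennreal) \<Rightarrow> ('a \<Rightarrow> real) \<Rightarrow> bool" where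
  "represents_c_M S P \<Delta> \<phi> \<mu> \<L> \<nu> d \<longleftrightarrow>
     measured_lamination (S - P) \<L> \<nu> \<and> compact (\<Union>\<L>) \<and>
     (\<forall>p\<in>P. d p = decoration S P \<Delta> \<phi> \<mu> p) \<and>
     (\<forall>e\<in>\<Delta>. transversal (S - P) \<L> e) \<and>
     (\<forall>C\<in>triangles S P \<Delta>. \<exists>K \<Psi>.
        (\<forall>k<3. corner_band \<L> (\<phi> C) k (K k) (\<Psi> k) \<and>
           \<nu> (\<phi> C ` \<Psi> k ` (K k \<times> {0})) =
             ennreal (corner_width \<phi> \<mu> C k - d (\<phi> C (vtx k)))) \<and>
        disjoint_family_on (\<lambda>k. \<Psi> k ` (K k \<times> {0..1})) {..<3} \<and>
        {z \<in> model_triangle - vtx ` {..<3}. \<phi> C z \<in> \<Union>\<L>} = (\<Union>k<3. \<Psi> k ` (K k \<times> {0..1})))"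

definition tropical_triangle_inequalities ::
  "'a::topological_space set \<Rightarrow> 'a set \<Rightarrow> 'a set set \<Rightarrow> ('a set \<Rightarrow> complex \<Rightarrow> 'a) \<Rightarrow>
   ('a set \<Rightarrow> real) \<Rightarrow> bool" where
  "tropical_triangle_inequalities S P \<Delta> \<phi> \<mu> \<longleftrightarrow>
     (\<forall>C\<in>triangles S P \<Delta>. let a = \<phi> C ` side 0; b = \<phi> C ` side 1; c = \<phi> C ` side 2 in
        \<mu> a \<le> max (\<mu> b) (\<mu> c) \<and> \<mu> b \<le> max (\<mu> a) (\<mu> c) \<and> \<mu> c \<le> max (\<mu> a) (\<mu> b))"

end

theory Submission
  imports Defs
begin

text \<open>On an edge \<open>e\<close>, place a crossing point \<open>x\<close> of the lamination at distance
  \<open>d p + \<nu>(between p and x) + \<nu>{x} / 2\<close> from the end of \<open>e\<close> at \<open>p\<close>. The distances from the two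
  ends add up to \<open>\<mu> e\<close>. An arc around a corner preserves the distance to the vertex of that
  corner, and this distance is at most the corner width. If the two sides at the corner have
  different measures, then by the tropical inequalities the corner width is half of the smaller
  measure, so the vertex of the corner is the nearer end on both sides. In every case
  the distance to the nearer end is the same at both ends of the arc. Hence it is constant along a leaf. Since the measure has full support,
  only finitely many points of an edge have a given distance to the nearer end, so following the
  arcs of a leaf leads back to the starting point and gives a simple closed curve. A leaf crosses
  the edges countably often, so it is a countable disjoint union of such curves, and by
  Sierpinski's theorem there is only one of them.\<close>

section \<open>Closed curves from chains of arcs\<close>

text \<open>\<open>corner_band\<close> says nothing about the order in which its arcs meet a side,
  nor how the bands of two corners share a side, yet the distance of a crossing point from a vertex
  depends on which arcs lie between. Planar topology supplies this: disjoint arcs around one corner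
  are nested and arcs around different corners are separated, since otherwise the Fashoda meeting
  theorem produces an intersection. A second obstacle is that an edge is parametrised by two sides
  of triangles, possibly in opposite directions. The minimum of the distances to the two ends does
  not see the direction, and splitting an atom evenly keeps the two distances symmetric. Decorations
  may be negative; they are only added to the distances, so their sign does not matter. Bands can be
  Cantor sets, so a chain of arcs might a priori be infinite; the level confines it to a finite set,
  on which passing along an arc and switching arcs at a crossing point are two fixed-point-free
  involutions.\<close>

lemma path_connected_countable_closed_partition:
  assumes l: "path_connected l" and "countable \<C>" and dis: "pairwise disjnt \<C>"
    and clo: "\<And>c. c \<in> \<C> \<Longrightarrow> closed c" and un: "\<Union>\<C> = l" and c: "c \<in> \<C>" "c \<noteq> {}"
  shows "c = l"
proof
  show "c \<subseteq> l" using c un by blast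
  show "l \<subseteq> c"
  proof
    fix y assume "y \<in> l"
    obtain x where x: "x \<in> c" using c by blast
    then have "x \<in> l" using c un by blast
    then obtain p where p: "path p" "path_image p \<subseteq> l" "pathstart p = x" "pathfinish p = y"
      using l \<open>y \<in> l\<close> unfolding path_connected_def by blast
    \<comment> \<open>By Sierpinski's theorem an interval is no countable disjoint union of two or
      more nonempty closed sets. Members of \<open>\<C>\<close> missed by the path have empty
      preimage and are removed. The one preimage left contains 0, so it is that of \<open>c\<close>,
      and it contains 1 as well.\<close>
    define \<U> where "\<U> = (\<lambda>c. {0..1} \<inter> p -` c) ` \<C> - {{}}"
    have "\<U> = {{0..1}}"
    proof (rule real_Sierpinski_lemma)
      show "countable \<U>" using assms(2) by (simp add: \<U>_def)
      show "disjoint \<U>"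
        using dis by (auto simp: \<U>_def pairwise_def disjnt_iff)
      show "\<Union>\<U> = {0..1}"
      proof -
        have "t \<in> \<Union>\<U>" if "t \<in> {0..1}" for t
        proof -
          have "p t \<in> \<Union>\<C>" using p(2) un that by (auto simp: path_image_def)
          then obtain c where "c \<in> \<C>" "p t \<in> c" by blast
          then show ?thesis unfolding \<U>_def using that
            by (intro UnionI[of "{0..1} \<inter> p -` c"]) auto
        qed
        then show ?thesis unfolding \<U>_def by blast
      qed
      show "closed C \<and> C \<noteq> {}" if "C \<in> \<U>" for C
        using that clo continuous_closed_preimage[OF p(1)[unfolded path_def]] unfolding \<U>_def
        by auto
    qed auto
    moreover have "0 \<in> {0..1} \<inter> p -` c"
      using x p(3) by (auto simp: pathstart_def)
    then have "{0..1} \<inter> p -` c \<in> \<U>"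
      using c(1) unfolding \<U>_def by blast
    ultimately have "1 \<in> {0..1} \<inter> p -` c" by simp
    then show "y \<in> c" using p(4) by (simp add: pathfinish_def)
  qed
qed

text \<open>Join each point to its images under \<open>\<sigma>\<close> and \<open>\<tau>\<close>.
  Every component of this graph is a cycle along which the two kinds of edges alternate, so the
  composition visits every other vertex. The last conclusion says that the skipped vertices are
  never visited; it will imply that no arc is run through backwards.\<close>

lemma involution_pair_cycle:
  assumes fin: "finite F"
    and \<sigma>: "\<And>f. f \<in> F \<Longrightarrow> \<sigma> f \<in> F \<and> \<sigma> (\<sigma> f) = f \<and> \<sigma> f \<noteq> f"
    and \<tau>: "\<And>f. f \<in> F \<Longrightarrow> \<tau> f \<in> F \<and> \<tau> (\<tau> f) = f \<and> \<tau> f \<noteq> f"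
    and f: "f \<in> F"
  obtains N where "N > 0" "((\<sigma> \<circ> \<tau>) ^^ N) f = f"
    "inj_on (\<lambda>n. ((\<sigma> \<circ> \<tau>) ^^ n) f) {..<N}"
    "\<And>i j. ((\<sigma> \<circ> \<tau>) ^^ i) f \<noteq> \<sigma> (((\<sigma> \<circ> \<tau>) ^^ j) f)"
proof -
  define q where "q n = ((\<sigma> \<circ> \<tau>) ^^ n) f" for n
  have q0: "q 0 = f" and qS: "q (Suc n) = \<sigma> (\<tau> (q n))" for n by (simp_all add: q_def)
  have qF: "q n \<in> F" for n
    by (induction n) (use f \<sigma> \<tau> in \<open>auto simp: q0 qS\<close>)
  have \<tau>q: "\<tau> (q n) \<in> F" "\<tau> (\<tau> (q n)) = q n" "\<tau> (q n) \<noteq> q n" for n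
    using \<tau>[OF qF] by auto
  have \<sigma>q: "\<sigma> (q n) \<noteq> q n" "\<sigma> (\<sigma> (q n)) = q n" "\<sigma> (q (Suc n)) = \<tau> (q n)" for n
    using \<sigma>[OF qF] \<sigma>[OF \<tau>q(1)] by (auto simp: qS)
  have shift1: "q i = q j" if "q (Suc i) = q (Suc j)" for i j
    using that \<sigma>q(3) \<tau>q(2) by metis
  have shift: "q i = q j" if "q (i + k) = q (j + k)" for i j k
    using that
  proof (induction k)
    case (Suc k)
    then show ?case using shift1[of "i + k" "j + k"] by simp
  qed simp
  have "\<not> inj q"
  proof
    assume "inj q"
    moreover have "finite (range q)" using fin qF by (meson finite_subset image_subsetI)
    ultimately show False using finite_imageD infinite_UNIV_nat by blast
  qed
  then obtain a b where "q a = q b" "a < b"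
    unfolding inj_def by (metis nat_neq_iff)
  then have "q 0 = q (b - a)" using shift[of 0 a "b - a"] by simp
  then have ex: "\<exists>n. n > 0 \<and> q n = q 0" using \<open>a < b\<close> by (metis zero_less_diff)
  define N where "N = (LEAST n. n > 0 \<and> q n = q 0)"
  have N: "N > 0" "q N = q 0" using LeastI_ex[OF ex] by (auto simp: N_def)
  have Nmin: "N \<le> n" if "n > 0" "q n = q 0" for n
    unfolding N_def using that by (blast intro: Least_le)
  have lt: "q i \<noteq> q j" if "i < j" "j < N" for i j
  proof
    assume "q i = q j"
    then have "q 0 = q (j - i)" using shift[of 0 i "j - i"] that by simp
    then show False using Nmin[of "j - i"] that by auto
  qed
  have inj: "inj_on q {..<N}"
    by (rule linorder_inj_onI) (use lt in auto)
  \<comment> \<open>A coincidence for the pair (i, j) yields one for (i + 1, j - 1), so the indices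
    approach each other until they agree or are adjacent. Then \<open>\<sigma>\<close> resp.
    \<open>\<tau>\<close> would have a fixed point.\<close>
  have le: "q i \<noteq> \<sigma> (q j)" if "i \<le> j" for i j
    using that
  proof (induction "j - i" arbitrary: i j rule: less_induct)
    case less
    consider "j = i" | "j = Suc i" | "Suc (Suc i) \<le> j" using less.prems by linarith
    then show ?case
    proof cases
      case 1 then show ?thesis using \<sigma>q(1)[of i] by simp
    next
      case 2 then show ?thesis using \<sigma>q(3)[of i] \<tau>q(3)[of i] by simp
    next
      case 3
      then obtain k where k: "j = Suc k" "Suc i \<le> k" by (metis Suc_le_D Suc_le_mono)
      show ?thesis
      proof
        assume "q i = \<sigma> (q j)"
        then have "q i = \<tau> (q k)" using k \<sigma>q(3)[of k] by simp
        then have "q (Suc i) = \<sigma> (q k)" using \<tau>q(2)[of k] qS[of i] by simp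
        then show False using less.hyps[of k "Suc i"] k by auto
      qed
    qed
  qed
  have "q i \<noteq> \<sigma> (q j)" for i j
    using le[of i j] le[of j i] \<sigma>q(2)[of j] \<sigma>q(2)[of i] by (metis nat_le_linear)
  moreover have "q = (\<lambda>n. ((\<sigma> \<circ> \<tau>) ^^ n) f)" by (simp add: fun_eq_iff q_def)
  ultimately show thesis using that[of N] N inj by simp
qed

lemma path_image_ends: "path_image p = insert (p 0) (insert (p 1) (p ` {0<..<1::real}))"
proof -
  have "{0..1::real} = insert 0 (insert 1 {0<..<1})" by auto
  then show ?thesis unfolding path_image_def by (metis image_insert)
qed

text \<open>The first \<open>N - 1\<close> arcs are joined to one simple arc and the last one closes
  it up; for \<open>N = 2\<close> the two share both end points, so only the closing step may allow
  two common points. For \<open>N = 1\<close> there is a single loop, which is not an arc and is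
  treated apart.\<close>

lemma cyclic_join_simple_path:
  fixes g :: "nat \<Rightarrow> real \<Rightarrow> 'a::topological_space"
  assumes N: "N > 0"
    and path: "\<And>i. i < N \<Longrightarrow> path (g i)"
    and inj: "\<And>i. i < N \<Longrightarrow> inj_on (g i) {0<..<1}"
    and st: "\<And>i. i < N \<Longrightarrow> g i 0 = x i" and fi: "\<And>i. i < N \<Longrightarrow> g i 1 = x (Suc i)"
    and xN: "x N = x 0" and injx: "inj_on x {..<N}"
    and mid: "\<And>i j t. i < N \<Longrightarrow> j < N \<Longrightarrow> 0 < t \<Longrightarrow> t < 1 \<Longrightarrow> g i t \<noteq> x j"
    and dis: "\<And>i j s t. i < N \<Longrightarrow> j < N \<Longrightarrow> i \<noteq> j \<Longrightarrow> 0 < s \<Longrightarrow> s < 1 \<Longrightarrow> 0 < t \<Longrightarrow> t < 1 \<Longrightarrow> g i s \<noteq> g j t"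
  shows "simple_closed_curve (\<Union>i<N. path_image (g i))"
proof (cases "N = 1")
  case True
  have "loop_free (g 0)"
    unfolding loop_free_def
  proof (intro ballI impI)
    fix s t :: real assume st': "s \<in> {0..1}" "t \<in> {0..1}" "g 0 s = g 0 t"
    have a: "g 0 0 = x 0" "g 0 1 = x 0" using st[of 0] fi[of 0] True xN by auto
    have m: "g 0 t \<noteq> x 0" if "0 < t" "t < 1" for t using mid[of 0 0] that True by auto
    show "s = t \<or> s = 0 \<and> t = 1 \<or> s = 1 \<and> t = 0"
    proof (cases "0 < s \<and> s < 1 \<and> 0 < t \<and> t < 1")
      case True then show ?thesis using st' inj[of 0] N by (auto simp: inj_on_def)
    next
      case False
      then show ?thesis using st' a m by (smt (verit, best) atLeastAtMost_iff)
    qed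
  qed
  then show ?thesis
    unfolding simple_closed_curve_def simple_path_def
    using path[of 0] st[of 0] fi[of 0] True xN
    by (intro exI[of _ "g 0"]) (auto simp: pathstart_def pathfinish_def)
next
  case False
  then have N2: "N \<ge> 2" using N by simp
  have xne: "x i \<noteq> x j" if "i < N" "j < N" "i \<noteq> j" for i j
    using injx that by (auto simp: inj_on_def)
  have xS: "x (Suc i) = x (Suc i mod N)" "Suc i mod N < N" "Suc i mod N \<noteq> i" if "i < N" for i
    using that xN N2 by (cases "Suc i = N"; auto)+
  have im: "path_image (g i) = {x i, x (Suc i)} \<union> g i ` {0<..<1}" if "i < N" for i
    using path_image_ends[of "g i"] st fi that by auto
  have arc: "arc (g i)" if "i < N" for i
    unfolding arc_def
  proof
    have m: "g i t \<noteq> x i" "g i t \<noteq> x (Suc i)" if "0 < t" "t < 1" for t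
      using mid[of i i] mid[of i "Suc i mod N"] that xS[OF \<open>i < N\<close>] \<open>i < N\<close> by auto
    have e: "x i \<noteq> x (Suc i)" using xne[of i "Suc i mod N"] xS[OF that] that by auto
    show "inj_on (g i) {0..1}"
    proof (rule inj_onI)
      fix s t :: real assume st': "s \<in> {0..1}" "t \<in> {0..1}" "g i s = g i t"
      show "s = t"
      proof (cases "0 < s \<and> s < 1 \<and> 0 < t \<and> t < 1")
        case True then show ?thesis using st' inj[OF that] by (auto simp: inj_on_def)
      next
        case False
        then show ?thesis using st' e m st[OF that] fi[OF that] by (smt (verit, best) atLeastAtMost_iff)
      qed
    qed
  qed (use path that in auto)
  have meet: "path_image (g i) \<inter> path_image (g j) \<subseteq> {x i, x (Suc i)} \<inter> {x j, x (Suc j)}"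
    if "i < N" "j < N" "i \<noteq> j" for i j
  proof -
    have "g i t \<notin> {x j, x (Suc j)}" "g j t \<notin> {x i, x (Suc i)}" if "0 < t" "t < 1" for t
      using mid[of i j] mid[of i "Suc j mod N"] mid[of j i] mid[of j "Suc i mod N"] that
        xS[OF \<open>i < N\<close>] xS[OF \<open>j < N\<close>] \<open>i < N\<close> \<open>j < N\<close> by auto
    moreover have "g i ` {0<..<1} \<inter> g j ` {0<..<1} = {}" using dis that by auto
    ultimately show ?thesis unfolding im[OF that(1)] im[OF that(2)] by fastforce
  qed
  \<comment> \<open>The bound \<open>Suc n < N\<close> keeps the end \<open>x (Suc n)\<close>
    different from all earlier vertices, so that the union is an arc and not yet a loop.\<close>
  have "\<exists>\<gamma>. arc \<gamma> \<and> \<gamma> 0 = x 0 \<and> \<gamma> 1 = x (Suc n) \<and> path_image \<gamma> = (\<Union>i<Suc n. path_image (g i))"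
    if "Suc n < N" for n
    using that
  proof (induction n)
    case 0
    then show ?case using arc st fi by (intro exI[of _ "g 0"]) auto
  next
    case (Suc n)
    then obtain \<gamma> where \<gamma>: "arc \<gamma>" "\<gamma> 0 = x 0" "\<gamma> 1 = x (Suc n)"
      "path_image \<gamma> = (\<Union>i<Suc n. path_image (g i))" by auto
    have "path_image \<gamma> \<inter> path_image (g (Suc n)) \<subseteq> {x (Suc n)}"
    proof -
      have "path_image (g i) \<inter> path_image (g (Suc n)) \<subseteq> {x (Suc n)}" if "i < Suc n" for i
      proof -
        have "x i \<noteq> x (Suc (Suc n))" "x (Suc i) \<noteq> x (Suc (Suc n))" "x i \<noteq> x (Suc n)"
          using xne[of i "Suc (Suc n)"] xne[of "Suc i" "Suc (Suc n)"] xne[of i "Suc n"] that Suc.prems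
          by auto
        then show ?thesis using meet[of i "Suc n"] that Suc.prems by auto
      qed
      then show ?thesis unfolding \<gamma>(4) by blast
    qed
    then have "arc (\<gamma> +++ g (Suc n))"
      using arc_join[of \<gamma> "g (Suc n)"] \<gamma> arc[of "Suc n"] st[of "Suc n"] Suc.prems
      by (auto simp: pathstart_def pathfinish_def)
    moreover have "path_image (\<gamma> +++ g (Suc n)) = (\<Union>i<Suc (Suc n). path_image (g i))"
      using path_image_join[of \<gamma> "g (Suc n)"] \<gamma> st[of "Suc n"] Suc.prems
      by (auto simp: pathstart_def pathfinish_def lessThan_Suc)
    ultimately show ?case
      using \<gamma> fi[of "Suc n"] Suc.prems
      by (intro exI[of _ "\<gamma> +++ g (Suc n)"]) (auto simp: joinpaths_def)
  qed
  note arcs = this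
  have e: "Suc (N - 2) = N - 1" "N - 1 < N" using N2 by auto
  obtain \<gamma> where \<gamma>: "arc \<gamma>" "\<gamma> 0 = x 0" "\<gamma> 1 = x (N - 1)"
      "path_image \<gamma> = (\<Union>i<N - 1. path_image (g i))"
    using arcs[of "N - 2", unfolded e(1), OF e(2)] by blast
  have Suc1: "Suc (N - 1) = N" using N by simp
  have "path_image (g i) \<inter> path_image (g (N - 1)) \<subseteq> {x 0, x (N - 1)}" if "i < N - 1" for i
    using meet[of i "N - 1"] that N2 Suc1 xN by auto
  then have "path_image \<gamma> \<inter> path_image (g (N - 1)) \<subseteq> {x 0, x (N - 1)}"
    unfolding \<gamma>(4) by blast
  then have "simple_path (\<gamma> +++ g (N - 1))"
    using simple_path_join_loop[of \<gamma> "g (N - 1)"] \<gamma> arc[of "N - 1"] st[of "N - 1"] fi[of "N - 1"] N xN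
    by (auto simp: pathstart_def pathfinish_def)
  moreover have "path_image (\<gamma> +++ g (N - 1)) = (\<Union>i<N. path_image (g i))"
    using path_image_join[of \<gamma> "g (N - 1)"] \<gamma> st[of "N - 1"] N lessThan_Suc[of "N - 1"]
    by (auto simp: pathstart_def pathfinish_def)
  ultimately show ?thesis
    unfolding simple_closed_curve_def using \<gamma> fi[of "N - 1"] N xN
    by (intro exI[of _ "\<gamma> +++ g (N - 1)"]) (auto simp: joinpaths_def pathstart_def pathfinish_def)
qed

text \<open>A possibly infinite graph of degree two drawn by arcs. In \<open>two\<close>, pairs of
  an arc and an end are counted, so an arc whose ends coincide contributes twice and closes up by
  itself. The function \<open>lv\<close> is preserved along arcs and takes each value on finitely
  many of them; this is what prevents a chain from running on forever.\<close>

locale arc_system =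
  fixes I :: "'i set" and h :: "'i \<Rightarrow> real \<Rightarrow> 'a::t2_space" and lv :: "'a \<Rightarrow> real"
  assumes path: "i \<in> I \<Longrightarrow> path (h i)"
    and inj: "i \<in> I \<Longrightarrow> inj_on (h i) {0<..<1}"
    and dis: "i \<in> I \<Longrightarrow> j \<in> I \<Longrightarrow> i \<noteq> j \<Longrightarrow> 0 < s \<Longrightarrow> s < 1 \<Longrightarrow> 0 < t \<Longrightarrow> t < 1 \<Longrightarrow> h i s \<noteq> h j t"
    and mid: "i \<in> I \<Longrightarrow> j \<in> I \<Longrightarrow> b \<in> {0, 1} \<Longrightarrow> 0 < t \<Longrightarrow> t < 1 \<Longrightarrow> h i t \<noteq> h j b"
    and two: "i \<in> I \<Longrightarrow> b \<in> {0, 1} \<Longrightarrow> card {(j, c). j \<in> I \<and> c \<in> {0, 1} \<and> h j c = h i b} = 2"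
    and level: "i \<in> I \<Longrightarrow> lv (h i 1) = lv (h i 0)"
    and finite_level: "finite {i \<in> I. lv (h i 0) = v}"
begin

text \<open>The pair \<open>(i, b)\<close> with \<open>b \<in> {0, 1}\<close> stands for an end of the arc \<open>i\<close>. Each arc has two ends, exchanged
  by \<open>opp\<close>, and exactly two ends sit at each end point, exchanged by \<open>adj\<close>.\<close>

definition ends :: "('i \<times> real) set" where "ends = I \<times> {0, 1}"
definition pt :: "'i \<times> real \<Rightarrow> 'a" where "pt f = h (fst f) (snd f)"
definition opp :: "'i \<times> real \<Rightarrow> 'i \<times> real" where "opp f = (fst f, 1 - snd f)"
definition adj :: "'i \<times> real \<Rightarrow> 'i \<times> real" where
  "adj f = (THE g. g \<in> ends \<and> pt g = pt f \<and> g \<noteq> f)"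

lemma opp: "f \<in> ends \<Longrightarrow> opp f \<in> ends \<and> opp (opp f) = f \<and> opp f \<noteq> f"
  by (auto simp: ends_def opp_def)

lemma adj_ex1: assumes "f \<in> ends" shows "\<exists>!g. g \<in> ends \<and> pt g = pt f \<and> g \<noteq> f"
proof -
  obtain i b where f: "f = (i, b)" "i \<in> I" "b \<in> {0, 1}" using assms by (auto simp: ends_def)
  define X where "X = {g \<in> ends. pt g = pt f}"
  have "X = {(j, c). j \<in> I \<and> c \<in> {0, 1} \<and> h j c = h i b}"
    by (auto simp: X_def ends_def pt_def f)
  then have "card X = 2" using two[OF f(2,3)] by simp
  then obtain a b where X: "X = {a, b}" "a \<noteq> b" unfolding card_2_iff by blast
  have "f \<in> X" using assms by (simp add: X_def)
  then consider "f = a" | "f = b" using X by blast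
  then have "\<exists>g. g \<in> X \<and> g \<noteq> f \<and> (\<forall>g'\<in>X. g' = f \<or> g' = g)"
  proof cases
    case 1
    then show ?thesis using X by (intro exI[of _ b]) blast
  next
    case 2
    then show ?thesis using X by (intro exI[of _ a]) blast
  qed
  then obtain g where g: "g \<in> X" "g \<noteq> f" "\<And>g'. g' \<in> X \<Longrightarrow> g' \<noteq> f \<Longrightarrow> g' = g" by blast
  show ?thesis
  proof (rule ex1I)
    show "g \<in> ends \<and> pt g = pt f \<and> g \<noteq> f" using g(1,2) unfolding X_def by blast
    show "g' = g" if "g' \<in> ends \<and> pt g' = pt f \<and> g' \<noteq> f" for g'
      using g(3)[of g'] that unfolding X_def by blast
  qed
qed

lemma adj: assumes "f \<in> ends"
  shows "adj f \<in> ends" "pt (adj f) = pt f" "adj f \<noteq> f"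
  using theI'[OF adj_ex1[OF assms]] unfolding adj_def by auto

lemma adj_unique: assumes "f \<in> ends" "g \<in> ends" "pt g = pt f" shows "g = f \<or> g = adj f"
  using adj_ex1[OF assms(1)] adj[OF assms(1)] assms by blast

lemma adj_adj: assumes "f \<in> ends" shows "adj (adj f) = f"
  using adj_unique[OF adj(1)[OF assms], of f] adj[OF assms] assms by auto

lemma lv_opp: "f \<in> ends \<Longrightarrow> lv (pt (opp f)) = lv (pt f)"
  using level by (auto simp: ends_def pt_def opp_def)

definition step :: "(('i \<times> real) \<times> ('i \<times> real)) set" where
  "step = {(f, g). f \<in> ends \<and> (g = opp f \<or> g = adj f)}"

definition circ :: "'i \<times> real \<Rightarrow> 'a set" where
  "circ f = (\<Union>g \<in> step\<^sup>* `` {f}. path_image (h (fst g)))"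

lemma sym_step: "sym step"
  unfolding sym_def step_def using opp adj adj_adj by auto

lemma step_ends: "(f, g) \<in> step\<^sup>* \<Longrightarrow> f \<in> ends \<Longrightarrow> g \<in> ends"
  by (induction rule: rtrancl_induct) (auto simp: step_def opp adj)

lemma circ_eq: assumes "(f, g) \<in> step\<^sup>*" shows "circ f = circ g"
proof -
  have "(g, f) \<in> step\<^sup>*" using sym_rtrancl[OF sym_step] assms unfolding sym_def by blast
  then have "step\<^sup>* `` {f} = step\<^sup>* `` {g}" using assms by (auto intro: rtrancl_trans)
  then show ?thesis by (simp add: circ_def)
qed

lemma arc_cases: assumes "z \<in> path_image (h i)"
  obtains t where "0 < t" "t < 1" "z = h i t" | b where "b \<in> {0, 1}" "z = h i b"
  using assms path_image_ends[of "h i"] by force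

text \<open>A common point is either interior to an arc, and then lies on no other arc, or it is the
  place of two ends, which \<open>adj\<close> exchanges. In both cases the ends behind the two
  unions are linked by \<open>step\<close>.\<close>

lemma circ_disjoint:
  assumes f: "f \<in> ends" and g: "g \<in> ends" and "circ f \<inter> circ g \<noteq> {}"
  shows "circ f = circ g"
proof -
  obtain z f' g' where z: "(f, f') \<in> step\<^sup>*" "(g, g') \<in> step\<^sup>*"
    "z \<in> path_image (h (fst f'))" "z \<in> path_image (h (fst g'))"
    using assms(3) unfolding circ_def by auto
  have e: "f' \<in> ends" "g' \<in> ends" using z step_ends f g by auto
  then have iI: "fst f' \<in> I" "fst g' \<in> I" by (auto simp: ends_def)
  have opp_eq: "circ u = circ w" if "u \<in> ends" "w \<in> ends" "fst u = fst w" for u w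
  proof -
    have "w = u \<or> w = opp u" using that by (cases u; cases w) (auto simp: ends_def opp_def)
    then have "(u, w) \<in> step\<^sup>*" using that by (auto simp: step_def)
    then show ?thesis by (rule circ_eq)
  qed
  have "circ f' = circ g'"
    using z(3)
  proof (cases rule: arc_cases)
    case (1 t)
    show ?thesis using z(4)
    proof (cases rule: arc_cases)
      case (1 s)
      then have "fst f' = fst g'" using dis[OF iI, of t s] \<open>0 < t\<close> \<open>t < 1\<close> \<open>z = h (fst f') t\<close> by metis
      then show ?thesis using opp_eq e by blast
    next
      case (2 b)
      then show ?thesis using mid[OF iI, of b t] 1 by metis
    qed
  next
    case (2 b)
    show ?thesis using z(4)
    proof (cases rule: arc_cases)
      case (1 s)
      then show ?thesis using mid[OF iI(2,1), of b s] 2 by metis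
    next
      case (2 c)
      let ?u = "(fst f', b)" and ?w = "(fst g', c)"
      have uw: "?u \<in> ends" "?w \<in> ends" "pt ?u = pt ?w"
        using 2 \<open>b \<in> {0, 1}\<close> \<open>z = h (fst f') b\<close> iI by (auto simp: ends_def pt_def)
      then have "?u = ?w \<or> ?u = adj ?w" using adj_unique by blast
      then have "(?w, ?u) \<in> step\<^sup>*" using uw by (auto simp: step_def)
      then have "circ ?u = circ ?w" using circ_eq by blast
      then show ?thesis using opp_eq[OF e(1) uw(1)] opp_eq[OF e(2) uw(2)] by simp
    qed
  qed
  then show ?thesis using circ_eq z by metis
qed

lemma circ_simple_closed_curve: assumes f: "f \<in> ends" shows "simple_closed_curve (circ f)"
proof -
  \<comment> \<open>The chain never leaves the level of \<open>f\<close>, and only finitely many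
    ends have this level; this turns the chain into a cycle.\<close>
  define F where "F = {g \<in> ends. lv (pt g) = lv (pt f)}"
  have "F \<subseteq> {i \<in> I. lv (h i 0) = lv (pt f)} \<times> {0, 1}"
    using level by (auto simp: F_def ends_def pt_def)
  then have finF: "finite F" using finite_level finite_subset by blast
  have adjF: "adj g \<in> F \<and> adj (adj g) = g \<and> adj g \<noteq> g" if "g \<in> F" for g
    using that adj adj_adj by (auto simp: F_def)
  have oppF: "opp g \<in> F \<and> opp (opp g) = g \<and> opp g \<noteq> g" if "g \<in> F" for g
    using that opp lv_opp by (auto simp: F_def)
  have fF: "f \<in> F" using f by (simp add: F_def)
  \<comment> \<open>The end \<open>q n\<close> is the one at which the n-th arc is entered:
    \<open>opp\<close> runs through that arc and \<open>adj\<close> passes to the next arc at the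
    same point.\<close>
  obtain N where N: "N > 0" "((adj \<circ> opp) ^^ N) f = f"
    "inj_on (\<lambda>n. ((adj \<circ> opp) ^^ n) f) {..<N}"
    "\<And>i j. ((adj \<circ> opp) ^^ i) f \<noteq> adj (((adj \<circ> opp) ^^ j) f)"
    using involution_pair_cycle[of F adj opp f, OF finF adjF oppF fF] by blast
  define q where "q n = ((adj \<circ> opp) ^^ n) f" for n
  have q0: "q 0 = f" and qS: "q (Suc n) = adj (opp (q n))" for n by (simp_all add: q_def)
  have qN: "q N = f" and injq: "inj_on q {..<N}" and nadj: "q i \<noteq> adj (q j)" for i j
    using N unfolding q_def by (auto simp: inj_on_def)
  have qe: "q n \<in> ends" for n by (induction n) (use f adj opp in \<open>auto simp: q0 qS\<close>)
  have qmod: "q n = q (n mod N)" for n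
  proof (induction n rule: less_induct)
    case (less n)
    show ?case
    proof (cases "n < N")
      case False
      have "q (N + k) = q k" for k by (induction k) (simp_all add: qN q0 qS)
      from this[of "n - N"] less[of "n - N"] False N(1) show ?thesis
        by (simp add: le_mod_geq)
    qed simp
  qed
  have arc_eq: "path_image (h (fst g)) = path_image (h (fst (opp g)))" for g by (simp add: opp_def)
  have opp_adj: "opp (q n) = adj (q (Suc n))" for n
    using adj_adj[of "opp (q n)"] opp[OF qe] by (simp add: qS)
  \<comment> \<open>The far end of an arc of the chain is \<open>adj\<close> of the next
    \<open>q\<close>, hence itself no \<open>q\<close>: an arc entered at one end is never entered
    at the other.\<close>
  have nopp: "q i \<noteq> opp (q j)" for i j
    using opp_adj nadj by metis
  define x where "x n = pt (q n)" for n
  define g where "g n = (if snd (q n) = 0 then h (fst (q n)) else reversepath (h (fst (q n))))" for n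
  have qI: "fst (q n) \<in> I" and qb: "snd (q n) \<in> {0, 1}" for n using qe[of n] by (auto simp: ends_def)
  have fst_ne: "fst (q i) \<noteq> fst (q j)" if "i < N" "j < N" "i \<noteq> j" for i j
  proof
    assume "fst (q i) = fst (q j)"
    then have "q i = q j \<or> q i = opp (q j)"
      using qb[of i] qb[of j] by (cases "q i"; cases "q j") (auto simp: opp_def)
    then show False using injq nopp that by (auto simp: inj_on_def)
  qed
  have gt: "\<exists>s. 0 < s \<and> s < 1 \<and> g n t = h (fst (q n)) s" if "0 < t" "t < 1" for n t
    using that by (cases "snd (q n) = 0")
      (auto simp: g_def reversepath_def intro: exI[of _ t] exI[of _ "1 - t"])
  have "simple_closed_curve (\<Union>n<N. path_image (g n))"
  proof (rule cyclic_join_simple_path[where x = x])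
    show "path (g i)" for i using path[OF qI] by (simp add: g_def)
    show "inj_on (g i) {0<..<1}" for i
    proof (rule inj_onI)
      fix s t :: real assume "s \<in> {0<..<1}" "t \<in> {0<..<1}" "g i s = g i t"
      then show "s = t"
        using inj_onD[OF inj[OF qI[of i]], of s t] inj_onD[OF inj[OF qI[of i]], of "1 - s" "1 - t"]
        by (auto simp: g_def reversepath_def split: if_splits)
    qed
    show "g i 0 = x i" for i using qb[of i] by (auto simp: g_def x_def pt_def reversepath_def)
    show "g i 1 = x (Suc i)" for i
    proof -
      have "x (Suc i) = pt (opp (q i))" using adj(2) opp qe by (simp add: x_def qS)
      then show ?thesis using qb[of i] by (auto simp: g_def pt_def opp_def reversepath_def)
    qed
    show "x N = x 0" by (simp add: x_def qN q0)
    show "inj_on x {..<N}"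
    proof (rule inj_onI)
      fix i j assume ij: "i \<in> {..<N}" "j \<in> {..<N}" "x i = x j"
      then have "q i = q j" using adj_unique[OF qe qe] nadj by (metis x_def)
      then show "i = j" using injq ij by (auto simp: inj_on_def)
    qed
    show "g i t \<noteq> x j" if "0 < t" "t < 1" for i j t
      using gt[OF that, of i] mid[OF qI qI qb] by (metis x_def pt_def)
    show "g i s \<noteq> g j t" if "i < N" "j < N" "i \<noteq> j" "0 < s" "s < 1" "0 < t" "t < 1" for i j s t
      using gt[of s i] gt[of t j] that dis[OF qI qI fst_ne[OF that(1-3)]] by metis
  qed (use N in auto)
  moreover have "(\<Union>n<N. path_image (g n)) = circ f"
  proof -
    have "path_image (g n) = path_image (h (fst (q n)))" for n by (simp add: g_def)
    moreover have "circ f = (\<Union>n<N. path_image (h (fst (q n))))"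
    proof
      have "\<exists>n. g = q n \<or> g = opp (q n)" if "(f, g) \<in> step\<^sup>*" for g
        using that
      proof (induction rule: rtrancl_induct)
        case base then show ?case using q0 by metis
      next
        case (step g g')
        then obtain n where n: "g = q n \<or> g = opp (q n)" by blast
        \<comment> \<open>Going back one place in the cycle; adding \<open>N\<close> first avoids
          the truncated subtraction at \<open>n = 0\<close>.\<close>
        have a: "adj (q n) = opp (q (n + N - 1))"
          using opp_adj[of "n + N - 1"] N(1) qmod[of n] qmod[of "n + N"] by simp
        have b: "adj (opp (q n)) = q (Suc n)" "opp (opp (q n)) = q n"
          using opp[OF qe, of n] by (simp_all add: qS)
        have "g' = opp g \<or> g' = adj g" using step.hyps(2) by (simp add: step_def)
        then show ?case using n a b by metis
      qed
      then show "circ f \<subseteq> (\<Union>n<N. path_image (h (fst (q n))))"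
        unfolding circ_def using arc_eq qmod N(1)
        by (smt (verit, del_insts) Image_singleton_iff UN_iff lessThan_iff mod_less_divisor subsetI)
      have "(f, q n) \<in> step\<^sup>*" for n
      proof (induction n)
        case (Suc n)
        have "(q n, opp (q n)) \<in> step" "(opp (q n), q (Suc n)) \<in> step"
          using qe opp by (auto simp: step_def qS)
        then show ?case using Suc by (meson rtrancl.rtrancl_into_rtrancl)
      qed (simp add: q0)
      then show "(\<Union>n<N. path_image (h (fst (q n)))) \<subseteq> circ f"
        unfolding circ_def by blast
    qed
    ultimately show ?thesis by simp
  qed
  ultimately show ?thesis by simp
qed

lemma leaf_simple_closed_curve:
  assumes L: "pairwise disjnt \<L>" and un: "\<Union>\<L> = (\<Union>i\<in>I. path_image (h i))"
    and arc: "\<And>i. i \<in> I \<Longrightarrow> \<exists>l\<in>\<L>. path_image (h i) \<subseteq> l"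
    and l: "l \<in> \<L>" "path_connected l" "l \<noteq> {}"
    and count: "countable {i \<in> I. path_image (h i) \<subseteq> l}"
  shows "simple_closed_curve l"
proof -
  define J where "J = {i \<in> I. path_image (h i) \<subseteq> l}"
  \<comment> \<open>Leaves are disjoint and each arc lies in some leaf, so an arc that meets
    \<open>l\<close> is contained in it; in particular, arcs sharing an end point stay in one
    leaf.\<close>
  have inl: "path_image (h i) \<subseteq> l" if "i \<in> I" "z \<in> path_image (h i)" "z \<in> l" for i z
    using arc[OF that(1)] that l(1) L by (auto simp: pairwise_def disjnt_iff)
  have sub: "path_image (h (fst g)) \<subseteq> l"
    if "(f, g) \<in> step\<^sup>*" "f \<in> ends" "path_image (h (fst f)) \<subseteq> l" for f g
    using that
  proof (induction rule: rtrancl_induct)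
    case (step g g')
    have ge: "g \<in> ends" using step.hyps(2) by (simp add: step_def)
    have pt: "pt g \<in> path_image (h (fst g))" if "g \<in> ends" for g
      using that by (auto simp: ends_def pt_def path_image_def)
    have gl: "path_image (h (fst g)) \<subseteq> l" using step by blast
    have "fst (adj g) \<in> I" using adj(1)[OF ge] by (auto simp: ends_def)
    then have "path_image (h (fst (adj g))) \<subseteq> l"
      using inl[of "fst (adj g)" "pt g"] pt[OF ge] pt[OF adj(1)[OF ge]] adj(2)[OF ge] gl by auto
    then show ?case using step.hyps(2) gl by (auto simp: step_def opp_def)
  qed
  define \<C> where "\<C> = (\<lambda>i. circ (i, 0)) ` J"
  have Je: "(i, 0) \<in> ends" if "i \<in> J" for i using that by (simp add: J_def ends_def)
  have self: "path_image (h i) \<subseteq> circ (i, 0)" for i unfolding circ_def by force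
  have "\<Union>\<C> = l"
  proof
    show "\<Union>\<C> \<subseteq> l" using sub Je unfolding \<C>_def circ_def by (fastforce simp: J_def)
    show "l \<subseteq> \<Union>\<C>"
    proof
      fix z assume z: "z \<in> l"
      then obtain i where i: "i \<in> I" "z \<in> path_image (h i)" using un l(1) by blast
      then have "i \<in> J" using inl z by (simp add: J_def)
      then show "z \<in> \<Union>\<C>" using self[of i] i by (auto simp: \<C>_def)
    qed
  qed
  moreover have "countable \<C>" using count by (simp add: \<C>_def J_def)
  moreover have "pairwise disjnt \<C>"
    unfolding pairwise_def \<C>_def disjnt_def using circ_disjoint[OF Je Je] by blast
  moreover have "simple_closed_curve c" if "c \<in> \<C>" for c
    using that circ_simple_closed_curve Je by (auto simp: \<C>_def)
  moreover have "closed c \<and> c \<noteq> {}" if "simple_closed_curve c" for c :: "'a set"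
    using that unfolding simple_closed_curve_def
    by (metis compact_imp_closed compact_path_image path_image_nonempty simple_path_imp_path)
  moreover obtain c where "c \<in> \<C>" using calculation(1) l(3) by blast
  ultimately show ?thesis
    using path_connected_countable_closed_partition[OF l(2), of \<C> c] by metis
qed

end

section \<open>Barycentric coordinates and crossing arcs in the model triangle\<close>

text \<open>The barycentric coordinate belonging to the vertex \<open>k\<close>: the vertices are
  unit vectors with mutual inner products -1/2, so \<open>1 + 2 * (z \<bullet> vtx k)\<close> equals
  3 at \<open>vtx k\<close> and 0 at the other two.\<close>

definition bary :: "nat \<Rightarrow> complex \<Rightarrow> real" where
  "bary k z = (1 + 2 * (z \<bullet> vtx k)) / 3"

lemma vtx_add3 [simp]: "vtx (k + 3) = vtx k"
proof -
  have "2 * pi * real (k + 3) / 3 = 2 * pi * real k / 3 + 2 * pi" by (simp add: field_simps)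
  then show ?thesis unfolding vtx_def by (metis cis_mult cis_2pi mult.right_neutral)
qed

lemma vtx_mod: "vtx (k mod 3) = vtx k"
proof (induction k rule: less_induct)
  case (less k)
  show ?case
  proof (cases "k < 3")
    case False
    then show ?thesis using less[of "k - 3"] vtx_add3[of "k - 3"] by (simp add: le_mod_geq)
  qed simp
qed

lemma vtx_values: "vtx 0 = Complex 1 0" "vtx 1 = Complex (-1/2) (sqrt 3 / 2)"
  "vtx 2 = Complex (-1/2) (- sqrt 3 / 2)"
proof -
  show "vtx 0 = Complex 1 0" by (simp add: vtx_def complex_eq_iff)
  show "vtx 1 = Complex (-1/2) (sqrt 3 / 2)"
    by (simp add: vtx_def complex_eq_iff cos_120 sin_120)
  have "2 * pi * real 2 / 3 = pi + pi / 3" by simp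
  then have "cos (2 * pi * real 2 / 3) = -1/2" "sin (2 * pi * real 2 / 3) = - sqrt 3 / 2"
    by (simp_all only: cos_add sin_add cos_60 sin_60 cos_pi sin_pi)
  then show "vtx 2 = Complex (-1/2) (- sqrt 3 / 2)" by (simp add: vtx_def complex_eq_iff)
qed

lemma mod3_cases: obtains "k mod 3 = 0" | "k mod 3 = 1" | "k mod 3 = (2::nat)"
  by linarith

lemma mod3_distinct: "(k + 1) mod 3 \<noteq> k mod 3" "(k + 2) mod 3 \<noteq> k mod 3"
  "(k + 2) mod 3 \<noteq> (k + 1) mod (3::nat)"
  by (cases k rule: mod3_cases; simp add: mod_Suc)+

lemma mod3_exhaust: "j mod 3 = k mod 3 \<or> j mod 3 = (k + 1) mod 3 \<or> j mod 3 = (k + 2) mod (3::nat)"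
  by (cases j rule: mod3_cases; cases k rule: mod3_cases) (simp_all add: mod_Suc)

lemma bary_mod: "bary (k mod 3) z = bary k z"
  by (simp add: bary_def vtx_mod)

lemma bary_cong: "j mod 3 = k mod 3 \<Longrightarrow> bary j z = bary k z"
  by (metis bary_mod)

lemma bary_vtx: "bary j (vtx k) = (if j mod 3 = k mod 3 then 1 else 0)"
proof -
  have "bary (j mod 3) (vtx (k mod 3)) = (if j mod 3 = k mod 3 then 1 else 0)"
    by (cases j rule: mod3_cases; cases k rule: mod3_cases)
      (simp_all add: bary_def vtx_values inner_complex_def vtx_values[simplified])
  then show ?thesis by (simp add: bary_mod vtx_mod)
qed

lemma bary_sum: "bary k z + bary (k + 1) z + bary (k + 2) z = 1"
proof -
  have *: "bary 0 z + bary 1 z + bary 2 z = 1"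
    by (simp add: bary_def vtx_values[simplified] inner_complex_def field_simps)
  have "bary (k mod 3) z + bary ((k + 1) mod 3) z + bary ((k + 2) mod 3) z = 1"
  proof (cases k rule: mod3_cases)
    case 1
    then have "(k + 1) mod 3 = 1" "(k + 2) mod 3 = 2" by presburger+
    with 1 * show ?thesis by simp
  next
    case 2
    then have "(k + 1) mod 3 = 2" "(k + 2) mod 3 = 0" by presburger+
    with 2 * show ?thesis by simp
  next
    case 3
    then have "(k + 1) mod 3 = 0" "(k + 2) mod 3 = 1" by presburger+
    with 3 * show ?thesis by simp
  qed
  then show ?thesis by (simp add: bary_mod)
qed

lemma bary_eqI: assumes "bary (k + 1) z = bary (k + 1) w" "bary (k + 2) z = bary (k + 2) w"
  shows "z = w"
proof -
  have "bary k z = bary k w" using bary_sum[of k z] bary_sum[of k w] assms by simp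
  then have "bary (k mod 3) z = bary (k mod 3) w" "bary ((k + 1) mod 3) z = bary ((k + 1) mod 3) w"
      "bary ((k + 2) mod 3) z = bary ((k + 2) mod 3) w"
    using assms by (simp_all add: bary_mod)
  moreover have "{k mod 3, (k + 1) mod 3, (k + 2) mod 3} = {0, 1, 2}"
    by (cases k rule: mod3_cases) (auto simp: mod_simps, presburger+)
  ultimately have "bary 0 z = bary 0 w" "bary 1 z = bary 1 w" "bary 2 z = bary 2 w"
    by (metis insert_iff singletonD)+
  then show ?thesis
    by (simp add: bary_def vtx_values[simplified] inner_complex_def complex_eq_iff)
qed

lemma bary_affine: "bary k ((1 - u) *\<^sub>R z + u *\<^sub>R w) = (1 - u) * bary k z + u * bary k w"
  by (simp add: bary_def inner_simps algebra_simps divide_simps)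

lemma continuous_on_bary [continuous_intros]: "continuous_on S f \<Longrightarrow> continuous_on S (\<lambda>x. bary k (f x))"
  unfolding bary_def by (intro continuous_intros) auto

lemma bary_nonneg: assumes "z \<in> model_triangle" shows "0 \<le> bary k z"
proof -
  have "convex {z. 0 \<le> bary k z}"
    unfolding convex_alt by (simp add: bary_affine)
  moreover have "{vtx 0, vtx 1, vtx 2} \<subseteq> {z. 0 \<le> bary k z}"
    by (simp add: bary_vtx)
  ultimately show ?thesis
    using assms hull_minimal unfolding model_triangle_def by blast
qed

lemma bary_pos_interior: assumes "z \<in> interior model_triangle" shows "0 < bary k z"
proof -
  obtain e where e: "e > 0" "ball z e \<subseteq> model_triangle"
    using assms by (meson mem_interior)
  have n: "norm (vtx k) = 1" by (simp add: vtx_def)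
  \<comment> \<open>Moving away from \<open>vtx k\<close> by \<open>e / 2\<close> lowers the
    coordinate by \<open>e / 3\<close> without leaving the triangle, so the coordinate was at least
    \<open>e / 3\<close>.\<close>
  define w where "w = z - (e / 2) *\<^sub>R vtx k"
  have "w \<in> ball z e" using e n by (simp add: w_def dist_norm)
  then have "0 \<le> bary k w" using e bary_nonneg by blast
  moreover have "bary k w = bary k z - e / 3"
    using n by (simp add: bary_def w_def inner_diff_left dot_square_norm field_simps)
  ultimately show ?thesis using e(1) by simp
qed

definition side_pt :: "nat \<Rightarrow> real \<Rightarrow> complex" where
  "side_pt k r = (1 - r) *\<^sub>R vtx (k + 1) + r *\<^sub>R vtx (k + 2)"

lemma bary_side_pt: "bary k (side_pt k r) = 0" "bary (k + 1) (side_pt k r) = 1 - r"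
  "bary (k + 2) (side_pt k r) = r"
proof -
  show "bary k (side_pt k r) = 0" "bary (k + 1) (side_pt k r) = 1 - r"
    "bary (k + 2) (side_pt k r) = r"
    unfolding side_pt_def bary_affine bary_vtx using mod3_distinct[of k] by (simp_all only: if_True if_False) auto
qed

lemma side_eq: "side k = side_pt k ` {0<..<1}"
proof -
  have "vtx (k + 1) \<noteq> vtx (k + 2)"
  proof
    assume "vtx (k + 1) = vtx (k + 2)"
    then have "bary (k + 1) (vtx (k + 1)) = bary (k + 1) (vtx (k + 2))" by simp
    then show False using mod3_distinct(3)[of k] unfolding bary_vtx by simp
  qed
  then show ?thesis
    unfolding side_def open_segment_image_interval side_pt_def[abs_def] by simp
qed

lemma side_iff: "z \<in> side k \<longleftrightarrow> bary k z = 0 \<and> 0 < bary (k + 1) z \<and> 0 < bary (k + 2) z"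
proof
  assume "z \<in> side k"
  then show "bary k z = 0 \<and> 0 < bary (k + 1) z \<and> 0 < bary (k + 2) z"
    unfolding side_eq using bary_side_pt[of k] by auto
next
  assume a: "bary k z = 0 \<and> 0 < bary (k + 1) z \<and> 0 < bary (k + 2) z"
  have "z = side_pt k (bary (k + 2) z)"
    by (rule bary_eqI[of k]) (use a bary_sum[of k z] bary_side_pt[of k] in auto)
  then show "z \<in> side k" unfolding side_eq using a bary_sum[of k z] by auto
qed

lemma side_pt_bary: assumes "z \<in> side k" shows "side_pt k (bary (k + 2) z) = z"
  by (rule bary_eqI[of k]) (use assms[unfolded side_iff] bary_sum[of k z] bary_side_pt[of k] in auto)

lemma side_pt_in_triangle: assumes "r \<in> {0..1}" shows "side_pt k r \<in> model_triangle"
proof -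
  have v: "vtx j \<in> model_triangle" for j
    using vtx_mod[of j, symmetric] hull_subset[of "{vtx 0, vtx 1, vtx 2}" convex]
    unfolding model_triangle_def by (cases j rule: mod3_cases) auto
  then show ?thesis using assms convexD_alt[of model_triangle "vtx (k+1)" "vtx (k+2)" r]
    unfolding side_pt_def model_triangle_def by (auto simp: convex_convex_hull)
qed

lemma side_subset: "side k \<subseteq> model_triangle - vtx ` {..<3}"
proof
  fix z assume z: "z \<in> side k"
  have "z \<noteq> vtx j" for j
  proof
    assume "z = vtx j"
    then have "j mod 3 = (k + 1) mod 3" "j mod 3 = (k + 2) mod 3"
      using z unfolding side_iff by (auto simp: bary_vtx split: if_splits)
    then show False using mod3_distinct(3)[of k] by simp
  qed
  moreover have "z \<in> model_triangle" using z side_pt_in_triangle unfolding side_eq by fastforce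
  ultimately show "z \<in> model_triangle - vtx ` {..<3}" by blast
qed

lemma side_disjoint_interior: "side k \<inter> interior model_triangle = {}"
proof -
  have False if "z \<in> side k" "z \<in> interior model_triangle" for z
    using bary_pos_interior[OF that(2), of k] that(1) by (simp add: side_iff)
  then show ?thesis by blast
qed

lemma side_disjoint: assumes "z \<in> side j" "z \<in> side k" shows "j mod 3 = k mod 3"
proof (rule ccontr)
  assume "j mod 3 \<noteq> k mod 3"
  then have "j mod 3 = (k + 1) mod 3 \<or> j mod 3 = (k + 2) mod 3" using mod3_exhaust by blast
  then have "bary j z = bary (k + 1) z \<or> bary j z = bary (k + 2) z" using bary_cong[of j] by metis
  then show False using assms unfolding side_iff by linarith
qed

lemma side_mod: "side (k mod 3) = side k"
proof -
  have "(k mod 3 + 1) mod 3 = (k + 1) mod 3" "(k mod 3 + 2) mod 3 = (k + 2) mod 3"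
    by (rule mod_add_left_eq)+
  then have "bary (k mod 3 + 1) z = bary (k + 1) z" "bary (k mod 3 + 2) z = bary (k + 2) z" for z
    using bary_cong by blast+
  then show ?thesis unfolding set_eq_iff side_iff bary_mod by simp
qed

text \<open>Unfolding the quadrant at the vertex \<open>k\<close> to a half plane, so that the two sides at this
  vertex become consecutive intervals of the bounding line.\<close>

definition unfold :: "nat \<Rightarrow> complex \<Rightarrow> real^2" where
  "unfold k z = vector [bary (k + 2) z - bary (k + 1) z, min (bary (k + 1) z) (bary (k + 2) z)]"

lemma unfold_nth [simp]: "unfold k z $ 1 = bary (k + 2) z - bary (k + 1) z"
  "unfold k z $ 2 = min (bary (k + 1) z) (bary (k + 2) z)"
  by (simp_all add: unfold_def)

lemma unfold_inj: assumes "unfold k z = unfold k w" shows "z = w"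
proof (rule bary_eqI[of k])
  have "unfold k z $ 1 = unfold k w $ 1" "unfold k z $ 2 = unfold k w $ 2" using assms by auto
  then show "bary (k + 1) z = bary (k + 1) w" "bary (k + 2) z = bary (k + 2) w"
    by (auto simp: min_def split: if_splits)
qed

lemma continuous_on_unfold: "continuous_on S (unfold k)"
proof -
  have "continuous_on S (\<lambda>z. unfold k z $ i)" for i
    using exhaust_2[of i] unfolding unfold_def
    by (elim disjE) (auto intro!: continuous_intros simp: vector_2)
  then have "continuous_on S (\<lambda>z. \<chi> i. unfold k z $ i)" by (rule continuous_on_vec_lambda)
  then show ?thesis by (simp add: vec_lambda_eta)
qed

text \<open>With the vertex \<open>k\<close> as origin, \<open>f\<close> joins the two sides of the
  quadrant, while \<open>g\<close> starts at a boundary point between the ends of \<open>f\<close>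
  and finishes beyond \<open>f 1\<close>. Unfolding puts the four ends on a line in interlaced
  order, where the Fashoda theorem applies. The paths are confined to the quadrant and not to the
  triangle, so that they may be prolonged past the side \<open>k\<close>.\<close>

lemma quadrant_crossing:
  assumes f: "path f" "\<And>t. t \<in> {0..1} \<Longrightarrow> 0 \<le> bary (k + 1) (f t) \<and> 0 \<le> bary (k + 2) (f t)"
    and g: "path g" "\<And>t. t \<in> {0..1} \<Longrightarrow> 0 \<le> bary (k + 1) (g t) \<and> 0 \<le> bary (k + 2) (g t)"
    and fs: "bary (k + 2) (f 0) = 0" and ff: "bary (k + 1) (f 1) = 0"
    and gs: "bary (k + 2) (g 0) = 0 \<and> bary (k + 1) (g 0) < bary (k + 1) (f 0) \<or>
             bary (k + 1) (g 0) = 0 \<and> bary (k + 2) (g 0) < bary (k + 2) (f 1)"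
    and gf: "bary (k + 1) (g 1) = 0" "bary (k + 2) (f 1) < bary (k + 2) (g 1)"
    and pos: "0 < bary (k + 1) (f 0)" "0 < bary (k + 2) (f 1)"
  shows "path_image f \<inter> path_image g \<noteq> {}"
proof -
  have "bounded (unfold k ` (path_image f \<union> path_image g))"
    using f(1) g(1) by (intro compact_imp_bounded compact_continuous_image continuous_on_unfold)
      (auto intro: compact_path_image)
  then obtain B where B: "\<And>z. z \<in> path_image f \<union> path_image g \<Longrightarrow> norm (unfold k z) \<le> B"
    unfolding bounded_iff by blast
  \<comment> \<open>The bottom edge of this box lies on the line to which the boundary of the
    quadrant is unfolded, and \<open>B\<close> bounds both unfolded paths.\<close>
  define a b where "a = (vector [-B, 0] :: real^2)" and "b = (vector [B, B] :: real^2)"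
  have ab: "a $ 1 = -B" "a $ 2 = 0" "b $ 1 = B" "b $ 2 = B" by (simp_all add: a_def b_def)
  have box: "unfold k z \<in> cbox a b"
    if "z \<in> path_image f \<union> path_image g" "0 \<le> bary (k + 1) z" "0 \<le> bary (k + 2) z" for z
  proof -
    have "\<bar>unfold k z $ i\<bar> \<le> B" for i using B[OF that(1)] component_le_norm_cart order_trans by blast
    from this[of 1] this[of 2] show ?thesis using that
      unfolding mem_box_cart forall_2 ab by auto
  qed
  have p: "path (unfold k \<circ> f)" "path (unfold k \<circ> g)"
    using f(1) g(1) path_continuous_image continuous_on_unfold by blast+
  obtain z where "z \<in> path_image (unfold k \<circ> f)" "z \<in> path_image (unfold k \<circ> g)"
  proof (rule fashoda_interlace[OF p, of a b])
    show "path_image (unfold k \<circ> f) \<subseteq> cbox a b" "path_image (unfold k \<circ> g) \<subseteq> cbox a b"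
      using box f(2) g(2) by (auto simp: path_image_def)
    have n: "0 \<le> bary (k + 1) (f 0)" "0 \<le> bary (k + 2) (f 1)" "0 \<le> bary (k + 1) (g 0)"
        "0 \<le> bary (k + 2) (g 0)" "0 \<le> bary (k + 2) (g 1)"
      using f(2)[of 0] f(2)[of 1] g(2)[of 0] g(2)[of 1] by auto
    show "pathstart (unfold k \<circ> f) $ 2 = a $ 2" "pathfinish (unfold k \<circ> f) $ 2 = a $ 2"
      "pathstart (unfold k \<circ> g) $ 2 = a $ 2" "pathfinish (unfold k \<circ> g) $ 2 = a $ 2"
      using fs ff gs gf n by (auto simp: pathstart_def pathfinish_def ab)
    show "pathstart (unfold k \<circ> f) $ 1 < pathstart (unfold k \<circ> g) $ 1"
      "pathstart (unfold k \<circ> g) $ 1 < pathfinish (unfold k \<circ> f) $ 1"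
      "pathfinish (unfold k \<circ> f) $ 1 < pathfinish (unfold k \<circ> g) $ 1"
      using fs ff gs gf n pos by (auto simp: pathstart_def pathfinish_def)
  qed auto
  then obtain x y where xy: "x \<in> path_image f" "y \<in> path_image g" "unfold k x = unfold k y"
    by (auto simp: path_image_compose)
  then have "x = y" using unfold_inj by blast
  then show ?thesis using xy by blast
qed

section \<open>Nesting and separation of disjoint arcs around corners\<close>

definition corner_arc :: "nat \<Rightarrow> (real \<Rightarrow> complex) \<Rightarrow> bool" where
  "corner_arc k f \<longleftrightarrow> path f \<and> f 0 \<in> side (k + 1) \<and> f 1 \<in> side (k + 2) \<and>
     (\<forall>t\<in>{0<..<1}. f t \<in> interior model_triangle)"

lemma bary_add3 [simp]: "bary (k + 3) z = bary k z"
  by (rule bary_cong) simp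

lemma bary_shift: "bary (k + 1 + 1) z = bary (k + 2) z" "bary (k + 1 + 2) z = bary k z"
  "bary (k + 2 + 1) z = bary k z" "bary (k + 2 + 2) z = bary (k + 1) z"
  using bary_add3[of k z] bary_add3[of "k + 1" z] by (simp_all del: bary_add3 add: eval_nat_numeral)

lemma side_cong: "j mod 3 = k mod 3 \<Longrightarrow> side j = side k"
  by (metis side_mod)

lemma corner_arcD:
  assumes "corner_arc k f"
  shows "path f" "bary (k + 1) (f 0) = 0" "0 < bary (k + 2) (f 0)" "bary (k + 2) (f 1) = 0"
    "0 < bary (k + 1) (f 1)" "\<And>j t. t \<in> {0..1} \<Longrightarrow> 0 \<le> bary j (f t)"
    "\<And>t. t \<in> {0..1} \<Longrightarrow> 0 < bary k (f t)"
proof -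
  have f: "path f" "f 0 \<in> side (k + 1)" "f 1 \<in> side (k + 2)"
    "\<And>t. 0 < t \<Longrightarrow> t < 1 \<Longrightarrow> f t \<in> interior model_triangle"
    using assms by (auto simp: corner_arc_def)
  show "path f" by (rule f)
  have s0: "bary (k + 1) (f 0) = 0 \<and> 0 < bary (k + 2) (f 0) \<and> 0 < bary k (f 0)"
    using f(2)[unfolded side_iff bary_shift] by blast
  have s1: "bary (k + 2) (f 1) = 0 \<and> 0 < bary k (f 1) \<and> 0 < bary (k + 1) (f 1)"
    using f(3)[unfolded side_iff bary_shift] by blast
  show "bary (k + 1) (f 0) = 0" "0 < bary (k + 2) (f 0)" "bary (k + 2) (f 1) = 0"
    "0 < bary (k + 1) (f 1)" using s0 s1 by auto
  have "f t \<in> model_triangle" if "t \<in> {0..1}" for t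
  proof (cases "t = 0 \<or> t = 1")
    case True
    then show ?thesis using f(2,3) side_subset by blast
  next
    case False
    then show ?thesis using f(4)[of t] that interior_subset by fastforce
  qed
  then show "0 \<le> bary j (f t)" if "t \<in> {0..1}" for j t using bary_nonneg that by blast
  show "0 < bary k (f t)" if "t \<in> {0..1}" for t
  proof (cases "t = 0 \<or> t = 1")
    case True
    then show ?thesis using s0 s1 by blast
  next
    case False
    then show ?thesis using f(4)[of t] that bary_pos_interior by fastforce
  qed
qed

text \<open>If \<open>g\<close> were nearer to the vertex \<open>k\<close> than \<open>f\<close> on
  one side but farther away on the other, the four ends would interlace on the unfolded boundary and
  the arcs would cross.\<close>

lemma corner_arcs_nested:
  assumes f: "corner_arc k f" and g: "corner_arc k g"
    and disj: "path_image f \<inter> path_image g = {}"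
    and less: "bary k (f 0) < bary k (g 0)"
  shows "bary (k + 1) (g 1) < bary (k + 1) (f 1)"
proof (rule ccontr)
  note F = corner_arcD[OF f] and G = corner_arcD[OF g]
  assume "\<not> ?thesis"
  moreover have "bary (k + 1) (g 1) \<noteq> bary (k + 1) (f 1)"
  proof
    assume "bary (k + 1) (g 1) = bary (k + 1) (f 1)"
    then have "f 1 = g 1" using bary_eqI[of k "f 1" "g 1"] F(4) G(4) by simp
    then show False using disj pathfinish_in_path_image[of f] pathfinish_in_path_image[of g]
      by (auto simp: pathfinish_def)
  qed
  ultimately have gt: "bary (k + 1) (f 1) < bary (k + 1) (g 1)" by simp
  have lt: "bary (k + 2) (g 0) < bary (k + 2) (f 0)"
    using less F(2) G(2) bary_sum[of k "f 0"] bary_sum[of k "g 0"] by simp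
  \<comment> \<open>Corner arcs start on the side \<open>k + 1\<close>, whereas
    \<open>quadrant_crossing\<close> expects a start on the side \<open>k + 2\<close>, where
    \<open>bary (k + 2)\<close> vanishes; hence the reversal.\<close>
  have "path (reversepath f)" "path (reversepath g)" using F(1) G(1) by simp_all
  then have "path_image (reversepath g) \<inter> path_image (reversepath f) \<noteq> {}"
    by (rule_tac quadrant_crossing[where k = k])
      (use F G gt lt in \<open>auto simp: reversepath_def[of f] reversepath_def[of g]\<close>)
  then show False using disj by auto
qed

text \<open>Both arcs reach the side \<open>k + 1\<close>, \<open>f\<close> at its start and
  \<open>g\<close> at its finish. If \<open>g 1\<close> were between the vertex \<open>k\<close> and
  \<open>f 0\<close>, then \<open>g\<close> would have to cross \<open>f\<close> in order to reach
  the side \<open>k\<close>.\<close>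

lemma corner_arcs_separated:
  assumes f: "corner_arc k f" and g: "corner_arc (k + 2) g"
    and disj: "path_image f \<inter> path_image g = {}"
  shows "bary k (g 1) < bary k (f 0)"
proof (rule ccontr)
  note F = corner_arcD[OF f] and G = corner_arcD[OF g]
  have g1: "bary (k + 1) (g 1) = 0" using G(4)[unfolded bary_shift] .
  have g0: "bary k (g 0) = 0" using G(2)[unfolded bary_shift] .
  assume "\<not> ?thesis"
  then have "bary (k + 2) (g 1) \<le> bary (k + 2) (f 0)"
    using g1 F(2) bary_sum[of k "f 0"] bary_sum[of k "g 1"] by simp
  moreover have "bary (k + 2) (g 1) \<noteq> bary (k + 2) (f 0)"
  proof
    assume "bary (k + 2) (g 1) = bary (k + 2) (f 0)"
    then have "f 0 = g 1" using bary_eqI[of k "f 0" "g 1"] F(2) g1 by simp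
    then show False using disj pathstart_in_path_image[of f] pathfinish_in_path_image[of g]
      by (auto simp: pathfinish_def pathstart_def)
  qed
  ultimately have lt: "bary (k + 2) (g 1) < bary (k + 2) (f 0)" by simp
  \<comment> \<open>The parameter -1 leads past the vertex \<open>k + 2\<close>, to the point with
    coordinates 2 and -1 at the vertices \<open>k + 2\<close> and \<open>k\<close>. As
    \<open>bary (k + 2)\<close> is below 2 at \<open>f 0\<close>, this point lies beyond
    \<open>f 0\<close>, as \<open>quadrant_crossing\<close> demands.\<close>
  define w where "w = side_pt (k + 1) (-1)"
  have w: "bary (k + 1) w = 0" "bary (k + 2) w = 2" "bary k w = -1"
    using bary_side_pt[of "k + 1" "-1", unfolded bary_shift] unfolding w_def by simp_all
  \<comment> \<open>Prolong \<open>g\<close> beyond the side \<open>k\<close> to a point \<open>w\<close> on the line through the side \<open>k + 1\<close>.\<close>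
  define G' where "G' = reversepath g +++ linepath (g 0) w"
  have line: "bary j (linepath (g 0) w t) = (1 - t) * bary j (g 0) + t * bary j w" for j t
    by (simp only: linepath_def bary_affine)
  have pG: "path G'" "path_image G' = path_image g \<union> path_image (linepath (g 0) w)"
  proof -
    have "pathfinish (reversepath g) = pathstart (linepath (g 0) w)"
      unfolding pathstart_linepath by (simp add: pathstart_def)
    then show "path G'" "path_image G' = path_image g \<union> path_image (linepath (g 0) w)"
      using G(1) by (simp_all add: G'_def path_image_join)
  qed
  have nn: "0 \<le> bary j (G' t)" if "t \<in> {0..1}" "j = k + 1 \<or> j = k + 2" for j t
  proof -
    have "G' t \<in> path_image g \<union> path_image (linepath (g 0) w)"
      using that(1) pG(2) by (auto simp: path_image_def)
    moreover have "0 \<le> bary j z" if "z \<in> path_image g" for z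
      using G(6) that by (auto simp: path_image_def)
    moreover have "0 \<le> bary j z" if "z \<in> path_image (linepath (g 0) w)" for z
    proof -
      obtain s where "s \<in> {0..1}" "z = linepath (g 0) w s" using \<open>z \<in> _\<close> unfolding path_image_def by blast
      then show ?thesis using line[of j s] w \<open>j = _ \<or> _\<close> G(6)[of 0 j] by auto
    qed
    ultimately show ?thesis by blast
  qed
  have "path_image (reversepath f) \<inter> path_image G' \<noteq> {}"
  proof (rule quadrant_crossing[where k = k])
    have e: "G' 0 = g 1" "G' 1 = w" by (auto simp: G'_def joinpaths_def reversepath_def linepath_def)
    have "bary (k + 2) (f 0) < 2"
      using bary_sum[of k "f 0"] F(2) F(7)[of 0] by auto
    then show "bary (k + 2) (reversepath f 1) < bary (k + 2) (G' 1)"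
      using e w by (simp add: reversepath_def)
    show "bary (k + 2) (G' 0) = 0 \<and> bary (k + 1) (G' 0) < bary (k + 1) (reversepath f 0) \<or>
             bary (k + 1) (G' 0) = 0 \<and> bary (k + 2) (G' 0) < bary (k + 2) (reversepath f 1)"
      using e g1 lt by (simp add: reversepath_def)
    show "bary (k + 1) (G' 1) = 0" using e w by simp
    show "path (reversepath f)" using F(1) by simp
  qed (use F nn pG(1) in \<open>auto simp: reversepath_def[of f]\<close>)
  then obtain z where z: "z \<in> path_image f" "z \<in> path_image G'" by auto
  \<comment> \<open>The crossing cannot lie on \<open>g\<close> itself, and on the prolongation
    \<open>bary k\<close> is at most 0 while it is positive along \<open>f\<close>.\<close>
  then have "z \<in> path_image (linepath (g 0) w)" using pG(2) disj by blast
  then obtain s where "s \<in> {0..1}" "z = linepath (g 0) w s" unfolding path_image_def by blast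
  then have "bary k z \<le> 0" using line[of k s] g0 w by simp
  moreover have "0 < bary k z" using z(1) F(7) by (auto simp: path_image_def)
  ultimately show False by simp
qed

section \<open>Parametrisations of an open arc whose ends may coincide\<close>

definition open_arc :: "(real \<Rightarrow> 'a::topological_space) \<Rightarrow> 'a set \<Rightarrow> bool" where
  "open_arc u e \<longleftrightarrow> path u \<and> inj_on u {0<..<1} \<and> u ` {0<..<1} = e \<and> u 0 \<notin> e \<and> u 1 \<notin> e"

lemma reflect_unit: "(\<lambda>t. 1 - t) ` {0<..<1::real} = {0<..<1}"
  by (auto intro: image_eqI[of _ _ "1 - x" for x])

lemma open_arc_reverse: "open_arc u e \<Longrightarrow> open_arc (\<lambda>t. u (1 - t)) e"
proof -
  assume u: "open_arc u e"
  have "(\<lambda>t. u (1 - t)) ` {0<..<1} = u ` ((\<lambda>t. 1 - t) ` {0<..<1::real})" by (simp add: image_image)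
  also note reflect_unit
  finally have im: "(\<lambda>t. u (1 - t)) ` {0<..<1} = u ` {0<..<1}" .
  have "inj_on (\<lambda>t. u (1 - t)) {0<..<1}"
  proof (rule inj_onI)
    fix s t :: real assume "s \<in> {0<..<1}" "t \<in> {0<..<1}" "u (1 - s) = u (1 - t)"
    then show "s = t" using u inj_onD[of u "{0<..<1}" "1 - s" "1 - t"] by (auto simp: open_arc_def)
  qed
  moreover have "path (\<lambda>t. u (1 - t))"
    using u path_reversepath[of u] by (simp add: open_arc_def reversepath_def)
  ultimately show ?thesis using u im by (simp add: open_arc_def)
qed

text \<open>As complements of compact sets in \<open>e\<close>, the two pieces will be relatively
  open and Borel; the ends cause no trouble because \<open>u 0\<close> and \<open>u 1\<close> lie
  outside \<open>e\<close>.\<close>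

lemma open_arc_image:
  assumes u: "open_arc u e" and r: "r \<in> {0<..<1}"
  shows "u ` {0<..<r} = e - u ` {r..1}" "u ` {r<..<1} = e - u ` {0..r}"
proof -
  have inj: "inj_on u {0<..<1}" and e: "u ` {0<..<1} = e" "u 0 \<notin> e" "u 1 \<notin> e"
    using u by (auto simp: open_arc_def)
  have d: "{0<..<1} = {0<..<r} \<union> {r..<1}" "{0<..<1} = {0<..r} \<union> {r<..<1}"
    "{r..1} = insert 1 {r..<1}" "{0..r} = insert 0 {0<..r}" using r by auto
  have "u ` {0<..<r} \<inter> u ` {r..<1} = {}" "u ` {0<..r} \<inter> u ` {r<..<1} = {}"
  proof -
    have "{0<..<r} \<inter> {r..<1} = {}" "{0<..r} \<inter> {r<..<1} = {}" by auto
    then show "u ` {0<..<r} \<inter> u ` {r..<1} = {}" "u ` {0<..r} \<inter> u ` {r<..<1} = {}"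
      using r inj_on_image_Int[OF inj, of "{0<..<r}" "{r..<1}"]
        inj_on_image_Int[OF inj, of "{0<..r}" "{r<..<1}"] by (simp_all add: subset_eq)
  qed
  moreover have "e = u ` {0<..<r} \<union> u ` {r..<1}" "e = u ` {0<..r} \<union> u ` {r<..<1}"
    using e(1) d(1,2) by (metis image_Un)+
  ultimately show "u ` {0<..<r} = e - u ` {r..1}" "u ` {r<..<1} = e - u ` {0..r}"
    unfolding d(3,4) using e(2,3) by auto
qed

text \<open>The transition is \<open>v\<close> followed by the inverse of \<open>u\<close>. It is
  continuous by compactness: the preimage of a closed set \<open>B\<close> is the preimage under
  \<open>v\<close> of the image of \<open>B \<inter> {0..1}\<close> under \<open>u\<close>, which is
  compact, and the ends of the interval add no points of \<open>e\<close>.\<close>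

lemma open_arc_transition:
  fixes u v :: "real \<Rightarrow> 'a::t2_space"
  assumes u: "open_arc u e" and v: "open_arc v e"
  obtains w where "continuous_on {0<..<1} w" "inj_on w {0<..<1}" "w ` {0<..<1} = {0<..<1}"
    "\<And>s. s \<in> {0<..<1} \<Longrightarrow> u (w s) = v s"
proof -
  have iu: "inj_on u {0<..<1}" and eu: "u ` {0<..<1} = e" "u 0 \<notin> e" "u 1 \<notin> e" and pu: "path u"
    using u by (auto simp: open_arc_def)
  have iv: "inj_on v {0<..<1}" and ev: "v ` {0<..<1} = e" and pv: "path v"
    using v by (auto simp: open_arc_def)
  define w where "w s = the_inv_into {0<..<1} u (v s)" for s
  have b: "bij_betw u {0<..<1} e" "bij_betw v {0<..<1} e"
    using iu eu iv ev by (auto simp: bij_betw_def)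
  then have "bij_betw (the_inv_into {0<..<1} u) e {0<..<1}" by (rule_tac bij_betw_the_inv_into)
  then have "bij_betw (the_inv_into {0<..<1} u \<circ> v) {0<..<1} {0<..<1}" using b(2) by (rule_tac bij_betw_trans)
  moreover have "the_inv_into {0<..<1} u \<circ> v = w" by (auto simp: w_def)
  ultimately have wb: "inj_on w {0<..<1}" "w ` {0<..<1} = {0<..<1}" by (auto simp: bij_betw_def)
  have uw: "u (w s) = v s" if "s \<in> {0<..<1}" for s
    unfolding w_def using that ev eu(1) by (intro f_the_inv_into_f[OF iu]) auto
  have "continuous_on {0<..<1} w"
    unfolding continuous_on_closed_invariant
  proof (intro allI impI)
    fix B :: "real set" assume B: "closed B"
    have "closed (u ` (B \<inter> {0..1}))"
      using pu B by (intro compact_imp_closed compact_continuous_image)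
        (auto simp: path_def compact_Int_closed Int_commute closed_Int_compact intro: continuous_on_subset)
    then have "closed ({0..1} \<inter> v -` (u ` (B \<inter> {0..1})))"
      using pv by (intro continuous_closed_preimage) (auto simp: path_def)
    moreover have "({0..1} \<inter> v -` (u ` (B \<inter> {0..1}))) \<inter> {0<..<1} = w -` B \<inter> {0<..<1}"
    proof (rule set_eqI)
      fix s
      show "s \<in> ({0..1} \<inter> v -` (u ` (B \<inter> {0..1}))) \<inter> {0<..<1} \<longleftrightarrow> s \<in> w -` B \<inter> {0<..<1}"
      proof (cases "s \<in> {0<..<1}")
        case True
        have ws: "w s \<in> {0<..<1}" using True wb(2) by blast
        have "v s \<in> e" using True ev by blast
        have "v s \<in> u ` (B \<inter> {0..1}) \<longleftrightarrow> w s \<in> B"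
        proof
          assume "v s \<in> u ` (B \<inter> {0..1})"
          then obtain r where r: "r \<in> B" "r \<in> {0..1}" "u r = v s" by auto
          then have "r \<noteq> 0" "r \<noteq> 1" using eu \<open>v s \<in> e\<close> by metis+
          then have "r \<in> {0<..<1}" using r by auto
          then have "r = w s" using inj_onD[OF iu, of r "w s"] ws uw[OF True] r by simp
          then show "w s \<in> B" using r by simp
        next
          assume "w s \<in> B"
          then show "v s \<in> u ` (B \<inter> {0..1})" using ws uw[OF True] by (metis IntI atLeastAtMost_iff greaterThanLessThan_iff imageI less_imp_le)
        qed
        then show ?thesis using True by auto
      next
        case False
        then show ?thesis unfolding Int_iff by blast
      qed
    qed
    ultimately show "\<exists>A. closed A \<and> A \<inter> {0<..<1} = w -` B \<inter> {0<..<1}" by blast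
  qed
  then show thesis using that wb uw by blast
qed

text \<open>As \<open>w\<close> is an increasing bijection, \<open>w s\<close> tends to 0 with
  \<open>s\<close>, so the two paths take common values arbitrarily close to both starting
  points.\<close>

lemma open_arc_same_start:
  fixes u v :: "real \<Rightarrow> 'a::t2_space"
  assumes u: "path u" and v: "path v" and w: "w ` {0<..<1} = {0<..<1}" "strict_mono_on {0<..<1} w"
    and uw: "\<And>s. s \<in> {0<..<1} \<Longrightarrow> u (w s) = v s"
  shows "u 0 = v 0"
proof (rule ccontr)
  assume "u 0 \<noteq> v 0"
  then obtain A B where AB: "open A" "open B" "u 0 \<in> A" "v 0 \<in> B" "A \<inter> B = {}"
    by (meson hausdorff)
  have "\<exists>\<delta>>0. \<forall>t\<in>{0..1}. t < \<delta> \<longrightarrow> p t \<in> D" if "path p" "open D" "p 0 \<in> D" for p :: "real \<Rightarrow> 'a" and D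
  proof -
    have "openin (top_of_set {0..1}) ({0..1} \<inter> p -` D)"
      using that by (intro continuous_openin_preimage_gen) (auto simp: path_def)
    moreover have "0 \<in> {0..1} \<inter> p -` D" using that by simp
    ultimately have "\<exists>\<delta>>0. \<forall>t\<in>{0..1}. dist t 0 < \<delta> \<longrightarrow> t \<in> {0..1} \<inter> p -` D"
      unfolding openin_euclidean_subtopology_iff by blast
    then show ?thesis by (auto simp: dist_real_def)
  qed
  from this[OF u AB(1,3)] this[OF v AB(2,4)] obtain \<delta> \<epsilon> where
    \<delta>: "\<delta> > 0" "\<And>t. t \<in> {0..1} \<Longrightarrow> t < \<delta> \<Longrightarrow> u t \<in> A" and
    \<epsilon>: "\<epsilon> > 0" "\<And>t. t \<in> {0..1} \<Longrightarrow> t < \<epsilon> \<Longrightarrow> v t \<in> B" by metis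
  have "min \<delta> 1 / 2 \<in> w ` {0<..<1}" using w(1) \<delta>(1) by auto
  then obtain s where s: "s \<in> {0<..<1}" "w s = min \<delta> 1 / 2" by auto
  define s' where "s' = min s (\<epsilon> / 2)"
  have s': "s' \<in> {0<..<1}" "s' \<le> s" "s' < \<epsilon>" using s \<epsilon>(1) by (auto simp: s'_def)
  then have "w s' \<le> w s" using w(2) s(1) by (metis order_le_less strict_mono_onD order_refl)
  moreover have "w s' \<in> {0<..<1}" using s'(1) w(1) by blast
  ultimately have "u (w s') \<in> A" using \<delta> s(2) by (intro \<delta>(2)) auto
  moreover have "v s' \<in> B" using \<epsilon>(2) s' by auto
  ultimately show False using uw[OF s'(1)] AB(5) by auto
qed

text \<open>This is all that the distances of a point from the ends of an edge depend on: the two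
  ends, and the pieces into which the point cuts the edge.\<close>

definition same_arc :: "(real \<Rightarrow> 'a) \<Rightarrow> (real \<Rightarrow> 'a) \<Rightarrow> bool" where
  "same_arc u v \<longleftrightarrow> u 0 = v 0 \<and> u 1 = v 1 \<and>
     (\<forall>r\<in>{0<..<1}. \<forall>s\<in>{0<..<1}. u r = v s \<longrightarrow>
        u ` {0<..<r} = v ` {0<..<s} \<and> u ` {r<..<1} = v ` {s<..<1})"

lemma same_arc_mono:
  fixes u v :: "real \<Rightarrow> 'a::t2_space"
  assumes u: "open_arc u e" and v: "open_arc v e" and w: "w ` {0<..<1} = {0<..<1}" "strict_mono_on {0<..<1} w"
    and uw: "\<And>s. s \<in> {0<..<1} \<Longrightarrow> u (w s) = v s"
  shows "same_arc u v"
proof -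
  have pu: "path u" and pv: "path v" and iu: "inj_on u {0<..<1}" using u v by (auto simp: open_arc_def)
  have 0: "u 0 = v 0" using open_arc_same_start[OF pu pv w uw] by simp
  have "(\<lambda>t. u (1 - t)) 0 = (\<lambda>t. v (1 - t)) 0"
  proof (rule open_arc_same_start[where w = "\<lambda>s. 1 - w (1 - s)"])
    show "path (\<lambda>t. u (1 - t))" "path (\<lambda>t. v (1 - t))"
      using open_arc_reverse u v by (auto simp: open_arc_def)
    show "(\<lambda>s. 1 - w (1 - s)) ` {0<..<1} = {0<..<1}"
    proof -
      have "(\<lambda>s. 1 - w (1 - s)) ` {0<..<1} = (\<lambda>t. 1 - t) ` w ` (\<lambda>t. 1 - t) ` {0<..<1}"
        by (simp add: image_image)
      then show ?thesis by (simp only: reflect_unit w(1))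
    qed
    show "strict_mono_on {0<..<1} (\<lambda>s. 1 - w (1 - s))"
      using w(2) by (auto simp: strict_mono_on_def)
    show "u (1 - (1 - w (1 - s))) = v (1 - s)" if "s \<in> {0<..<1}" for s
      using uw[of "1 - s"] that by simp
  qed
  then have 1: "u 1 = v 1" by simp
  have "u ` {0<..<r} = v ` {0<..<s} \<and> u ` {r<..<1} = v ` {s<..<1}"
    if rs: "r \<in> {0<..<1}" "s \<in> {0<..<1}" "u r = v s" for r s
  proof -
    have "w s \<in> {0<..<1}" using rs w(1) by blast
    then have r: "r = w s" using inj_onD[OF iu, of r "w s"] rs uw[OF rs(2)] by simp
    have lt: "w a < w b \<longleftrightarrow> a < b" if "a \<in> {0<..<1}" "b \<in> {0<..<1}" for a b
      using strict_mono_on_less[OF w(2)] that by auto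
    have "{0<..<r} = {t \<in> w ` {0<..<1}. t < w s}" using w(1) r rs(1) by auto
    also have "\<dots> = w ` {t \<in> {0<..<1}. t < s}" using lt rs(2) by blast
    also have "{t \<in> {0<..<1}. t < s} = {0<..<s}" using rs(2) by auto
    finally have l: "{0<..<r} = w ` {0<..<s}" .
    have "{r<..<1} = {t \<in> w ` {0<..<1}. w s < t}" using w(1) r rs(1) by auto
    also have "\<dots> = w ` {t \<in> {0<..<1}. s < t}" using lt rs(2) by blast
    also have "{t \<in> {0<..<1}. s < t} = {s<..<1}" using rs(2) by auto
    finally have h: "{r<..<1} = w ` {s<..<1}" .
    show ?thesis unfolding l h image_image using uw rs(2) by (auto intro!: image_cong)
  qed
  then show ?thesis using 0 1 by (simp add: same_arc_def)
qed

text \<open>The transition map is continuous and injective on an interval, hence monotone; in the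
  decreasing case \<open>v\<close> is reversed first.\<close>

lemma open_arc_unique:
  fixes u v :: "real \<Rightarrow> 'a::t2_space"
  assumes u: "open_arc u e" and v: "open_arc v e"
  shows "same_arc u v \<or> same_arc u (\<lambda>t. v (1 - t))"
proof -
  obtain w where w: "continuous_on {0<..<1} w" "inj_on w {0<..<1}" "w ` {0<..<1} = {0<..<1}"
    "\<And>s. s \<in> {0<..<1} \<Longrightarrow> u (w s) = v s"
    using open_arc_transition[OF u v] by metis
  have "strict_mono_on {0<..<1} w \<or> strict_antimono_on {0<..<1} w"
    using injective_eq_monotone_map[OF _ w(1)] w(2) is_interval_oo by blast
  then show ?thesis
  proof
    assume "strict_mono_on {0<..<1} w"
    then show ?thesis using same_arc_mono[OF u v w(3) _ w(4)] by blast
  next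
    assume anti: "strict_antimono_on {0<..<1} w"
    have "same_arc u (\<lambda>t. v (1 - t))"
    proof (rule same_arc_mono[OF u open_arc_reverse[OF v], of "\<lambda>s. w (1 - s)"])
      have "(\<lambda>s. w (1 - s)) ` {0<..<1} = w ` (\<lambda>t. 1 - t) ` {0<..<1}"
        by (simp add: image_image)
      then show "(\<lambda>s. w (1 - s)) ` {0<..<1} = {0<..<1}" by (simp only: reflect_unit w(3))
      show "strict_mono_on {0<..<1} (\<lambda>s. w (1 - s))"
        using anti by (auto simp: monotone_on_def)
      show "u (w (1 - s)) = v (1 - s)" if "s \<in> {0<..<1}" for s
        using w(4)[of "1 - s"] that by simp
    qed
    then show ?thesis by simp
  qed
qed

section \<open>Corner bands\<close>

text \<open>Every triangle has an edge as its side 0, and each of the finitely many edges occurs as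
  a side only twice. A cardinality of 2 entails finiteness, as infinite sets have
  \<open>card\<close> 0.\<close>

lemma finite_triangles:
  assumes "ideal_triangulation S P \<Delta> \<phi>"
  shows "finite (triangles S P \<Delta>)"
proof -
  let ?T = "triangles S P \<Delta>" and ?Y = "\<lambda>e. {(C, k). C \<in> triangles S P \<Delta> \<and> k < 3 \<and> \<phi> C ` side k = e}"
  have \<Delta>: "finite \<Delta>" and two: "\<And>e. e \<in> \<Delta> \<Longrightarrow> card (?Y e) = 2"
    and s: "\<And>C. C \<in> ?T \<Longrightarrow> \<phi> C ` side 0 \<in> \<Delta>"
    using assms unfolding ideal_triangulation_def by simp_all
  have "finite (?Y e)" if "e \<in> \<Delta>" for e
    using two[OF that] by (intro card_ge_0_finite) simp
  then have "finite (\<Union>e\<in>\<Delta>. fst ` ?Y e)" using \<Delta> by blast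
  moreover have "C \<in> (\<Union>e\<in>\<Delta>. fst ` ?Y e)" if "C \<in> ?T" for C
    using s[OF that] that by (intro UN_I[of "\<phi> C ` side 0"] image_eqI[of _ _ "(C, 0)"]) auto
  ultimately show ?thesis by (meson finite_subset subsetI)
qed

lemma mod3_add: "j mod 3 = k mod 3 \<Longrightarrow> (j + n) mod 3 = (k + n) mod (3::nat)"
  by (metis mod_add_left_eq)

lemma mod3_shift4: "(k + 2 + 2) mod 3 = (k + 1) mod (3::nat)"
proof -
  have "k + 2 + 2 = (k + 1) + 3" by simp
  then show ?thesis by (metis mod_add_self2)
qed

text \<open>The bands are indexed by all natural numbers, with period 3, so that the corners and sides of
  a triangle can be rotated without reducing indices.\<close>

locale banded_lamination =
  fixes S P :: "'a::t2_space set" and \<Delta> :: "'a set set" and \<phi> :: "'a set \<Rightarrow> complex \<Rightarrow> 'a"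
    and \<mu> :: "'a set \<Rightarrow> real" and \<L> :: "'a set set" and \<nu> :: "'a set \<Rightarrow> ennreal" and d :: "'a \<Rightarrow> real"
    and K :: "'a set \<Rightarrow> nat \<Rightarrow> real set" and \<Psi> :: "'a set \<Rightarrow> nat \<Rightarrow> real \<times> real \<Rightarrow> complex"
  assumes triangulation: "ideal_triangulation S P \<Delta> \<phi>"
    and measured: "measured_lamination (S - P) \<L> \<nu>"
    and compact_support: "compact (\<Union>\<L>)"
    and transv: "e \<in> \<Delta> \<Longrightarrow> transversal (S - P) \<L> e"
    and deco: "C \<in> triangles S P \<Delta> \<Longrightarrow> d (\<phi> C (vtx k)) \<le> corner_width \<phi> \<mu> C k"
    and band: "C \<in> triangles S P \<Delta> \<Longrightarrow> corner_band \<L> (\<phi> C) k (K C k) (\<Psi> C k)"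
    and K_mod: "K C (k mod 3) = K C k" and \<Psi>_mod: "\<Psi> C (k mod 3) = \<Psi> C k"
    and width: "C \<in> triangles S P \<Delta> \<Longrightarrow>
      \<nu> (\<phi> C ` \<Psi> C k ` (K C k \<times> {0})) = ennreal (corner_width \<phi> \<mu> C k - d (\<phi> C (vtx k)))"
    and bands_disjoint: "C \<in> triangles S P \<Delta> \<Longrightarrow> j mod 3 \<noteq> k mod 3 \<Longrightarrow>
      \<Psi> C j ` (K C j \<times> {0..1}) \<inter> \<Psi> C k ` (K C k \<times> {0..1}) = {}"
    and support: "C \<in> triangles S P \<Delta> \<Longrightarrow>
      {z \<in> model_triangle - vtx ` {..<3}. \<phi> C z \<in> \<Union>\<L>} = (\<Union>k<3. \<Psi> C k ` (K C k \<times> {0..1}))"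
    and tropical: "C \<in> triangles S P \<Delta> \<Longrightarrow>
      \<mu> (\<phi> C ` side k) \<le> max (\<mu> (\<phi> C ` side (k + 1))) (\<mu> (\<phi> C ` side (k + 2)))"
begin

abbreviation "M \<equiv> \<Union>\<L>"
abbreviation "T \<equiv> triangles S P \<Delta>"
abbreviation "edge C k \<equiv> \<phi> C ` side k"

definition u :: "'a set \<Rightarrow> nat \<Rightarrow> real \<Rightarrow> 'a" where "u C k r = \<phi> C (side_pt k r)"
definition st :: "'a set \<Rightarrow> nat \<Rightarrow> real \<Rightarrow> 'a" where "st C k y = \<phi> C (\<Psi> C k (y, 0))"
definition en :: "'a set \<Rightarrow> nat \<Rightarrow> real \<Rightarrow> 'a" where "en C k y = \<phi> C (\<Psi> C k (y, 1))"

text \<open>Positions of the ends of a band arc on the sides \<open>k + 1\<close> and \<open>k + 2\<close>. The parameter runs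
  towards vertex \<open>k\<close> on the first of these sides and away from it on the second.\<close>

definition \<rho>0 :: "'a set \<Rightarrow> nat \<Rightarrow> real \<Rightarrow> real" where "\<rho>0 C k y = bary k (\<Psi> C k (y, 0))"
definition \<rho>1 :: "'a set \<Rightarrow> nat \<Rightarrow> real \<Rightarrow> real" where "\<rho>1 C k y = bary (k + 1) (\<Psi> C k (y, 1))"

lemma K_cong: "j mod 3 = k mod 3 \<Longrightarrow> K C j = K C k" by (metis K_mod)
lemma \<Psi>_cong: "j mod 3 = k mod 3 \<Longrightarrow> \<Psi> C j = \<Psi> C k" by (metis \<Psi>_mod)

lemma triangle_map:
  assumes C: "C \<in> T"
  shows "continuous_on model_triangle (\<phi> C)" "inj_on (\<phi> C) (interior model_triangle)"
    "\<phi> C ` interior model_triangle = C" "\<phi> C (vtx k) \<in> P" "inj_on (\<phi> C) (side k)"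
    "edge C k \<in> \<Delta>"
proof -
  have *: "continuous_on model_triangle (\<phi> C)" "inj_on (\<phi> C) (interior model_triangle)"
    "\<phi> C ` interior model_triangle = C"
    "\<And>k. k < 3 \<Longrightarrow> \<phi> C (vtx k) \<in> P \<and> inj_on (\<phi> C) (side k) \<and> \<phi> C ` side k \<in> \<Delta>"
    using triangulation C unfolding ideal_triangulation_def by blast+
  then show "continuous_on model_triangle (\<phi> C)" "inj_on (\<phi> C) (interior model_triangle)"
    "\<phi> C ` interior model_triangle = C" by auto
  show "\<phi> C (vtx k) \<in> P" "inj_on (\<phi> C) (side k)" "edge C k \<in> \<Delta>"
    using *(4)[of "k mod 3"] by (auto simp: vtx_mod side_mod)
qed

lemma edge_subset: "e \<in> \<Delta> \<Longrightarrow> e \<subseteq> S - P"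
  and edge_two: "e \<in> \<Delta> \<Longrightarrow> card {(C, k). C \<in> T \<and> k < 3 \<and> \<phi> C ` side k = e} = 2"
  and pairwise_edges: "pairwise disjnt \<Delta>"
  using triangulation unfolding ideal_triangulation_def by simp_all

lemma edges_disjoint: "e \<in> \<Delta> \<Longrightarrow> e' \<in> \<Delta> \<Longrightarrow> x \<in> e \<Longrightarrow> x \<in> e' \<Longrightarrow> e = e'"
  using pairwise_edges unfolding pairwise_def disjnt_def by blast

lemma support_subset: "M \<subseteq> S - P"
  using measured unfolding measured_lamination_def lamination_def by (metis closedin_imp_subset)

lemma support_closed: "closed M"
  using compact_support by (rule compact_imp_closed)

lemma open_arc_u: assumes C: "C \<in> T" shows "open_arc (u C k) (edge C k)"
  unfolding open_arc_def
proof (intro conjI)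
  have c: "continuous_on {0..1} (side_pt k)"
    unfolding side_pt_def by (intro continuous_intros)
  then have "continuous_on {0..1} (\<lambda>r. \<phi> C (side_pt k r))"
    by (rule continuous_on_compose2[OF triangle_map(1)[OF C]]) (use side_pt_in_triangle in auto)
  then show "path (u C k)" by (simp add: path_def u_def[abs_def])
  show "u C k ` {0<..<1} = edge C k" by (simp add: side_eq u_def image_image)
  show "inj_on (u C k) {0<..<1}"
  proof (rule inj_onI)
    fix r s :: real assume rs: "r \<in> {0<..<1}" "s \<in> {0<..<1}" "u C k r = u C k s"
    then have "side_pt k r = side_pt k s"
      using inj_onD[OF triangle_map(5)[OF C, of k], of "side_pt k r" "side_pt k s"]
      by (simp add: u_def side_eq)
    then show "r = s" using bary_side_pt(3) by metis
  qed
  have "u C k 0 \<in> P" "u C k 1 \<in> P"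
    using triangle_map(4)[OF C] by (simp_all add: u_def side_pt_def)
  then show "u C k 0 \<notin> edge C k" "u C k 1 \<notin> edge C k"
    using edge_subset[OF triangle_map(6)[OF C]] by blast+
qed

lemma u_ends: "u C (k + 1) 1 = \<phi> C (vtx k)" "u C (k + 2) 0 = \<phi> C (vtx k)"
  using vtx_add3[of k] unfolding u_def side_pt_def by (simp_all add: eval_nat_numeral)

lemma band_facts:
  assumes C: "C \<in> T"
  shows "compact (K C k)" "continuous_on (K C k \<times> {0..1}) (\<Psi> C k)" "inj_on (\<Psi> C k) (K C k \<times> {0..1})"
    "\<And>y. y \<in> K C k \<Longrightarrow> \<exists>l\<in>\<L>. \<phi> C ` \<Psi> C k ` ({y} \<times> {0..1}) \<subseteq> l"
    "\<And>y. y \<in> K C k \<Longrightarrow> corner_arc k (\<lambda>t. \<Psi> C k (y, t))"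
proof -
  show c: "compact (K C k)" "continuous_on (K C k \<times> {0..1}) (\<Psi> C k)" "inj_on (\<Psi> C k) (K C k \<times> {0..1})"
    "\<And>y. y \<in> K C k \<Longrightarrow> \<exists>l\<in>\<L>. \<phi> C ` \<Psi> C k ` ({y} \<times> {0..1}) \<subseteq> l"
    using band[OF C, of k] unfolding corner_band_def by blast+
  fix y assume y: "y \<in> K C k"
  have "continuous_on {0..1} (\<lambda>t. \<Psi> C k (y, t))"
    by (rule continuous_on_compose2[OF c(2)]) (use y in \<open>auto intro!: continuous_intros\<close>)
  then show "corner_arc k (\<lambda>t. \<Psi> C k (y, t))"
    using band[OF C, of k] y unfolding corner_band_def corner_arc_def path_def by auto
qed

lemma arc_in_triangle:
  assumes "C \<in> T" "y \<in> K C k" "t \<in> {0..1}"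
  shows "\<Psi> C k (y, t) \<in> model_triangle" "\<phi> C (\<Psi> C k (y, t)) \<in> M"
proof -
  have *: "\<Psi> C k (y, t) = \<Psi> C (k mod 3) (y, t)" "y \<in> K C (k mod 3)"
    using assms(2) by (simp_all add: \<Psi>_mod K_mod)
  have "\<Psi> C k (y, t) \<in> (\<Union>k<3. \<Psi> C k ` (K C k \<times> {0..1}))"
    unfolding *(1) using *(2) assms(3) by (intro UN_I[of "k mod 3"]) auto
  then have "\<Psi> C k (y, t) \<in> {z \<in> model_triangle - vtx ` {..<3}. \<phi> C z \<in> \<Union>\<L>}"
    unfolding support[OF assms(1)] .
  then show "\<Psi> C k (y, t) \<in> model_triangle" "\<phi> C (\<Psi> C k (y, t)) \<in> M" by auto
qed

lemma arc_ends:
  assumes "C \<in> T" "y \<in> K C k"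
  shows "\<Psi> C k (y, 0) \<in> side (k + 1)" "\<Psi> C k (y, 1) \<in> side (k + 2)"
  using band_facts(5)[OF assms] by (auto simp: corner_arc_def)

lemma st_en:
  assumes C: "C \<in> T" and y: "y \<in> K C k"
  shows "st C k y = u C (k + 1) (\<rho>0 C k y)" "\<rho>0 C k y \<in> {0<..<1}" "st C k y \<in> M" "st C k y \<in> edge C (k + 1)"
    "en C k y = u C (k + 2) (\<rho>1 C k y)" "\<rho>1 C k y \<in> {0<..<1}" "en C k y \<in> M" "en C k y \<in> edge C (k + 2)"
proof -
  note e = arc_ends[OF C y]
  show "st C k y = u C (k + 1) (\<rho>0 C k y)"
    using side_pt_bary[OF e(1)] unfolding bary_shift by (simp add: st_def u_def \<rho>0_def)
  show "en C k y = u C (k + 2) (\<rho>1 C k y)"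
    using side_pt_bary[OF e(2)] unfolding bary_shift by (simp add: en_def u_def \<rho>1_def)
  show "st C k y \<in> M" "en C k y \<in> M"
    using arc_in_triangle[OF C y] by (auto simp: st_def en_def)
  show "st C k y \<in> edge C (k + 1)" "en C k y \<in> edge C (k + 2)" using e by (auto simp: st_def en_def)
  show "\<rho>0 C k y \<in> {0<..<1}"
    using e(1)[unfolded side_iff bary_shift] bary_sum[of k "\<Psi> C k (y, 0)"] by (auto simp: \<rho>0_def)
  show "\<rho>1 C k y \<in> {0<..<1}"
    using e(2)[unfolded side_iff bary_shift] bary_sum[of k "\<Psi> C k (y, 1)"] by (auto simp: \<rho>1_def)
qed

text \<open>Arcs around the corner \<open>k\<close> start on the side \<open>k + 1\<close>, finish
  on the side \<open>k + 2\<close> and are otherwise interior to the triangle. Solving for the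
  corner modulo 3, the side \<open>j\<close> carries the starts from the corner \<open>j + 2\<close>
  and the finishes from the corner \<open>j + 1\<close>.\<close>

lemma side_band:
  assumes C: "C \<in> T" and z: "z \<in> side j" "\<phi> C z \<in> M"
  obtains (start) y where "y \<in> K C (j + 2)" "z = \<Psi> C (j + 2) (y, 0)"
    | (finish) y where "y \<in> K C (j + 1)" "z = \<Psi> C (j + 1) (y, 1)"
proof -
  have "z \<in> {z \<in> model_triangle - vtx ` {..<3}. \<phi> C z \<in> \<Union>\<L>}"
    using side_subset z by (simp add: subset_iff)
  then have "z \<in> (\<Union>k<3. \<Psi> C k ` (K C k \<times> {0..1}))"
    unfolding support[OF C] .
  then obtain k y t where k: "y \<in> K C k" "t \<in> {0..1}" "z = \<Psi> C k (y, t)" by auto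
  have "z \<notin> interior model_triangle" using z(1) side_disjoint_interior by blast
  then have "\<not> (0 < t \<and> t < 1)" using band_facts(5)[OF C k(1)] k(3) by (auto simp: corner_arc_def)
  then consider "t = 0" | "t = 1" using k(2) by fastforce
  then show thesis
  proof cases
    case 1
    then have "z \<in> side (k + 1)" using arc_ends(1)[OF C k(1)] k(3) by simp
    then have "(k + 1) mod 3 = j mod 3" using side_disjoint z(1) by blast
    then have "(j + 2) mod 3 = k mod 3" using mod3_add[of "k + 1" j 2] by simp
    then show thesis using start[of y] k 1 K_cong \<Psi>_cong by metis
  next
    case 2
    then have "z \<in> side (k + 2)" using arc_ends(2)[OF C k(1)] k(3) by simp
    then have "(k + 2) mod 3 = j mod 3" using side_disjoint z(1) by blast
    then have "(j + 1) mod 3 = k mod 3" using mod3_add[of "k + 2" j 1] by simp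
    then show thesis using finish[of y] k 2 K_cong \<Psi>_cong by metis
  qed
qed

section \<open>Order of the crossing points along a side\<close>

lemma \<rho>_cong: assumes "j mod 3 = k mod 3" shows "\<rho>0 C j y = \<rho>0 C k y" "\<rho>1 C j y = \<rho>1 C k y"
proof -
  have "(j + 1) mod 3 = (k + 1) mod 3" using assms by (rule mod3_add)
  then show "\<rho>0 C j y = \<rho>0 C k y" "\<rho>1 C j y = \<rho>1 C k y"
    unfolding \<rho>0_def \<rho>1_def using \<Psi>_cong[OF assms] bary_cong assms by metis+
qed

text \<open>Nesting in terms of parameters; the order is reversed because the parameter runs towards
  the vertex \<open>k\<close> on one side and away from it on the other.\<close>

lemma order_same:
  assumes C: "C \<in> T" and y: "y \<in> K C k" "y' \<in> K C k"
  shows "\<rho>0 C k y < \<rho>0 C k y' \<longleftrightarrow> \<rho>1 C k y' < \<rho>1 C k y"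
proof -
  have imp: "\<rho>1 C k b < \<rho>1 C k a" if "a \<in> K C k" "b \<in> K C k" "\<rho>0 C k a < \<rho>0 C k b" for a b
  proof -
    have "a \<noteq> b" using that by auto
    then have "path_image (\<lambda>t. \<Psi> C k (a, t)) \<inter> path_image (\<lambda>t. \<Psi> C k (b, t)) = {}"
      using that(1,2) inj_onD[OF band_facts(3)[OF C]] unfolding path_image_def by fastforce
    then show ?thesis
      using corner_arcs_nested[OF band_facts(5)[OF C that(1)] band_facts(5)[OF C that(2)]] that(3)
      by (simp add: \<rho>0_def \<rho>1_def)
  qed
  have "y = y'" if "\<rho>0 C k y = \<rho>0 C k y'"
  proof -
    have "\<Psi> C k (y, 0) = \<Psi> C k (y', 0)"
      using side_pt_bary[OF arc_ends(1)[OF C y(1)]] side_pt_bary[OF arc_ends(1)[OF C y(2)]] that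
      unfolding bary_shift \<rho>0_def by simp
    then show ?thesis using inj_onD[OF band_facts(3)[OF C]] y by fastforce
  qed
  then show ?thesis using imp[OF y] imp[OF y(2,1)] by fastforce
qed

lemma order_separated:
  assumes C: "C \<in> T" and y: "y \<in> K C k" and y': "y' \<in> K C (k + 2)"
  shows "\<rho>1 C (k + 2) y' < \<rho>0 C k y"
proof -
  have "path_image (\<lambda>t. \<Psi> C k (y, t)) \<inter> path_image (\<lambda>t. \<Psi> C (k + 2) (y', t)) = {}"
    using bands_disjoint[OF C, of k "k + 2"] mod3_distinct(2)[of k] y y' unfolding path_image_def by fastforce
  from corner_arcs_separated[OF band_facts(5)[OF C y] band_facts(5)[OF C y'] this]
  show ?thesis unfolding \<rho>0_def \<rho>1_def bary_shift .
qed

text \<open>Between a crossing point of the band on the side \<open>k + 1\<close> and the vertex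
  \<open>k\<close> only arcs around \<open>k\<close> arrive: the other arcs on this side go around
  the vertex \<open>k + 2\<close> and stay nearer to it by \<open>order_separated\<close>.\<close>

lemma near_start:
  assumes C: "C \<in> T" and y: "y \<in> K C k"
  shows "u C (k + 1) ` {\<rho>0 C k y<..<1} \<inter> M = st C k ` {y' \<in> K C k. \<rho>0 C k y < \<rho>0 C k y'}"
proof (intro equalityI subsetI)
  fix x assume "x \<in> u C (k + 1) ` {\<rho>0 C k y<..<1} \<inter> M"
  then obtain r where "r \<in> {\<rho>0 C k y<..<1}" and r34: "x = \<phi> C (side_pt (k + 1) r)" "x \<in> M"
    unfolding u_def by (elim IntE imageE)
  then have r: "\<rho>0 C k y < r" "r < 1" "x = \<phi> C (side_pt (k + 1) r)" "x \<in> M" by simp_all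
  have "0 < r" using r(1) st_en(2)[OF C y] by auto
  then have s: "side_pt (k + 1) r \<in> side (k + 1)" using r by (auto simp: side_eq)
  have m: "(k + 1 + 2) mod 3 = k mod 3" by simp
  have br: "bary k (side_pt (k + 1) r) = r" using bary_side_pt(3)[of "k + 1" r] unfolding bary_shift .
  from C s r(4)[unfolded r(3)] show "x \<in> st C k ` {y' \<in> K C k. \<rho>0 C k y < \<rho>0 C k y'}"
  proof (cases rule: side_band)
    case (start y')
    then show ?thesis using r br unfolding K_cong[OF m] \<Psi>_cong[OF m]
      by (auto simp: st_def \<rho>0_def intro!: image_eqI[of _ _ y'])
  next
    case (finish y')
    then have "y' \<in> K C (k + 2)" "side_pt (k + 1) r = \<Psi> C (k + 2) (y', 1)" by auto
    then have "\<rho>1 C (k + 2) y' = r" using br unfolding \<rho>1_def bary_shift by simp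
    then show ?thesis using order_separated[OF C y \<open>y' \<in> K C (k + 2)\<close>] r by simp
  qed
next
  fix x assume "x \<in> st C k ` {y' \<in> K C k. \<rho>0 C k y < \<rho>0 C k y'}"
  then obtain y' where "y' \<in> K C k" "\<rho>0 C k y < \<rho>0 C k y'" "x = st C k y'" by auto
  then show "x \<in> u C (k + 1) ` {\<rho>0 C k y<..<1} \<inter> M"
    using st_en(1-3)[OF C \<open>y' \<in> K C k\<close>] by auto
qed

lemma near_finish:
  assumes C: "C \<in> T" and y: "y \<in> K C k"
  shows "u C (k + 2) ` {0<..<\<rho>1 C k y} \<inter> M = en C k ` {y' \<in> K C k. \<rho>1 C k y' < \<rho>1 C k y}"
proof (intro equalityI subsetI)
  fix x assume "x \<in> u C (k + 2) ` {0<..<\<rho>1 C k y} \<inter> M"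
  then obtain r where "r \<in> {0<..<\<rho>1 C k y}" and r34: "x = \<phi> C (side_pt (k + 2) r)" "x \<in> M"
    unfolding u_def by (elim IntE imageE)
  then have r: "r < \<rho>1 C k y" "0 < r" "x = \<phi> C (side_pt (k + 2) r)" "x \<in> M" by simp_all
  have "r < 1" using r(1) st_en(6)[OF C y] by auto
  then have s: "side_pt (k + 2) r \<in> side (k + 2)" using r by (auto simp: side_eq)
  have m: "(k + 2 + 1) mod 3 = k mod 3" "(k + 1 + 2) mod 3 = k mod 3" by simp_all
  have br: "bary (k + 1) (side_pt (k + 2) r) = r" using bary_side_pt(3)[of "k + 2" r] unfolding bary_shift .
  from C s r(4)[unfolded r(3)] show "x \<in> en C k ` {y' \<in> K C k. \<rho>1 C k y' < \<rho>1 C k y}"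
  proof (cases rule: side_band)
    case (finish y')
    then show ?thesis using r br unfolding K_cong[OF m(1)] \<Psi>_cong[OF m(1)]
      by (auto simp: en_def \<rho>1_def intro!: image_eqI[of _ _ y'])
  next
    case (start y')
    then have y': "y' \<in> K C (k + 1)" "side_pt (k + 2) r = \<Psi> C (k + 1) (y', 0)"
      unfolding K_cong[OF mod3_shift4] \<Psi>_cong[OF mod3_shift4] by auto
    then have "\<rho>0 C (k + 1) y' = r" using br unfolding \<rho>0_def by simp
    moreover have "\<rho>1 C k y < \<rho>0 C (k + 1) y'"
      using order_separated[OF C y'(1), of y] y unfolding K_cong[OF m(2)] \<rho>_cong[OF m(2)] by blast
    ultimately show ?thesis using r by simp
  qed
next
  fix x assume "x \<in> en C k ` {y' \<in> K C k. \<rho>1 C k y' < \<rho>1 C k y}"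
  then obtain y' where "y' \<in> K C k" "\<rho>1 C k y' < \<rho>1 C k y" "x = en C k y'" by auto
  then show "x \<in> u C (k + 2) ` {0<..<\<rho>1 C k y} \<inter> M"
    using st_en(5-7)[OF C \<open>y' \<in> K C k\<close>] by auto
qed

lemma edge_support:
  assumes C: "C \<in> T"
  shows "edge C j \<inter> M = st C (j + 2) ` K C (j + 2) \<union> en C (j + 1) ` K C (j + 1)"
proof (intro equalityI subsetI)
  fix x assume "x \<in> edge C j \<inter> M"
  then obtain z where z: "z \<in> side j" "\<phi> C z \<in> M" "x = \<phi> C z" by auto
  from C z(1,2) show "x \<in> st C (j + 2) ` K C (j + 2) \<union> en C (j + 1) ` K C (j + 1)"
    by (cases rule: side_band) (use z(3) in \<open>auto simp: st_def en_def\<close>)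
next
  have m: "(j + 2 + 1) mod 3 = j mod 3" "(j + 1 + 2) mod 3 = j mod 3" by simp_all
  fix x assume "x \<in> st C (j + 2) ` K C (j + 2) \<union> en C (j + 1) ` K C (j + 1)"
  then consider y where "y \<in> K C (j + 2)" "x = st C (j + 2) y"
    | y where "y \<in> K C (j + 1)" "x = en C (j + 1) y" by (elim UnE imageE) auto
  then show "x \<in> edge C j \<inter> M"
  proof cases
    case (1 y)
    then show ?thesis using st_en(3,4)[OF C 1(1)] unfolding side_cong[OF m(1)] by simp
  next
    case (2 y)
    then show ?thesis using st_en(7,8)[OF C 2(1)] unfolding side_cong[OF m(2)] by simp
  qed
qed

end

section \<open>Transverse measure of the ends of an edge\<close>

text \<open>The hypotheses on \<open>a\<close>, \<open>b\<close>, \<open>c\<close> say that the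
  largest of the three is attained at least twice. So either \<open>a = b\<close> or
  \<open>c = max a b\<close>; in the latter case \<open>t\<close> is at most half of both
  \<open>a\<close> and \<open>b\<close>, and both minima equal \<open>t\<close>.\<close>

lemma min_tropical:
  fixes a b c t :: real
  assumes "t \<le> (a + b - c) / 2" "c \<le> max a b" "a \<le> max b c" "b \<le> max c a"
  shows "min (a - t) t = min t (b - t)"
  using assms by (auto simp: min_def max_def split: if_splits)

context banded_lamination begin

definition meas_sets :: "'a set \<Rightarrow> 'a set set" where
  "meas_sets e = sets (restrict_space borel e)"

lemma meas_setsI: "B \<in> sets borel \<Longrightarrow> e \<inter> B \<in> meas_sets e"
  by (auto simp: meas_sets_def sets_restrict_space)

lemma meas_sets_subset: "A \<in> meas_sets e \<Longrightarrow> A \<subseteq> e"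
  by (auto simp: meas_sets_def sets_restrict_space)

lemma meas_sets_ops: assumes "A \<in> meas_sets e" "B \<in> meas_sets e"
  shows "A \<union> B \<in> meas_sets e" "A \<inter> B \<in> meas_sets e" "A - B \<in> meas_sets e"
  using assms unfolding meas_sets_def by auto

lemma compact_meas: "compact A \<Longrightarrow> A \<subseteq> e \<Longrightarrow> A \<in> meas_sets e"
  using meas_setsI[of A e] compact_imp_closed[of A] by (simp add: inf.absorb2)

lemma support_meas: "A \<in> meas_sets e \<Longrightarrow> A \<inter> M \<in> meas_sets e"
  using meas_sets_ops(2)[OF _ meas_setsI[of M e], of A] support_closed meas_sets_subset[of A e]
  by (simp add: Int_assoc[symmetric] inf.absorb1)

lemma transverse: "transverse_measure (S - P) \<L> \<nu>"
  using measured by (simp add: measured_lamination_def)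

lemma \<nu>_measure:
  assumes e: "e \<in> \<Delta>"
  shows "additive (meas_sets e) \<nu>" "increasing (meas_sets e) \<nu>"
    "openin (top_of_set e) V \<Longrightarrow> \<nu> V = 0 \<longleftrightarrow> V \<inter> M = {}"
proof -
  have *: "measure_space e (sets (restrict_space borel e)) \<nu>"
    "\<forall>V. openin (top_of_set e) V \<longrightarrow> (\<nu> V = 0) = (V \<inter> M = {})"
    using transverse transv[OF e] unfolding transverse_measure_def by simp_all
  have ms: "sigma_algebra e (meas_sets e)" "positive (meas_sets e) \<nu>" "countably_additive (meas_sets e) \<nu>"
    using *(1) by (auto simp: measure_space_def meas_sets_def)
  then interpret sigma_algebra e "meas_sets e" by simp
  show "additive (meas_sets e) \<nu>" using countably_additive_additive ms by simp
  then show "increasing (meas_sets e) \<nu>" using additive_increasing ms by simp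
  show "openin (top_of_set e) V \<Longrightarrow> \<nu> V = 0 \<longleftrightarrow> V \<inter> M = {}" using *(2) by simp
qed

text \<open>Full support makes the relatively open set \<open>e - M\<close> null, because it misses
  the support.\<close>

lemma \<nu>_support: assumes e: "e \<in> \<Delta>" and A: "A \<in> meas_sets e" shows "\<nu> (A \<inter> M) = \<nu> A"
proof -
  have "openin (top_of_set e) (e - M)"
    using openin_open_Int[of "- M" e] support_closed by (simp add: Diff_eq open_closed)
  then have z: "\<nu> (e - M) = 0" using \<nu>_measure(3)[OF e] by blast
  have m: "e - M \<in> meas_sets e" using meas_setsI[of "- M" e] support_closed by (simp add: Diff_eq)
  have AM: "A \<inter> M \<in> meas_sets e" "A - M \<in> meas_sets e"
    using support_meas[OF A] meas_sets_ops(3)[OF A, of "A \<inter> M"] by (auto simp: Diff_Int_distrib2 Diff_Int)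
  have "\<nu> (A - M) \<le> \<nu> (e - M)"
    using increasingD[OF \<nu>_measure(2)[OF e] _ AM(2) m] meas_sets_subset[OF A] by blast
  moreover have "\<nu> (A \<inter> M \<union> (A - M)) = \<nu> (A \<inter> M) + \<nu> (A - M)"
    by (rule additiveD[OF \<nu>_measure(1)[OF e] _ AM]) blast
  ultimately show ?thesis using z by (simp add: Int_Diff_Un)
qed

lemma st_en_compact:
  assumes C: "C \<in> T" and B: "compact B" "B \<subseteq> K C k"
  shows "compact (st C k ` B)" "compact (en C k ` B)"
proof -
  have "continuous_on B (\<lambda>y. \<phi> C (\<Psi> C k (y, t)))" if t: "t \<in> {0..1}" for t
  proof -
    have "continuous_on B (\<lambda>y. \<Psi> C k (y, t))"
      by (rule continuous_on_compose2[OF band_facts(2)[OF C]]) (use t B in \<open>auto intro!: continuous_intros\<close>)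
    then show ?thesis
      by (rule continuous_on_compose2[OF triangle_map(1)[OF C]]) (use arc_in_triangle(1)[OF C _ t] B in auto)
  qed
  from this[of 0] this[of 1] show "compact (st C k ` B)" "compact (en C k ` B)"
    using B(1) by (auto simp: st_def[abs_def] en_def[abs_def] intro!: compact_continuous_image)
qed

lemma st_inj: assumes C: "C \<in> T" shows "inj_on (st C k) (K C k)" "inj_on (en C k) (K C k)"
proof -
  show "inj_on (st C k) (K C k)"
  proof (rule inj_onI)
    fix y y' assume y: "y \<in> K C k" "y' \<in> K C k" "st C k y = st C k y'"
    then have "\<Psi> C k (y, 0) = \<Psi> C k (y', 0)"
      using inj_onD[OF triangle_map(5)[OF C] _ arc_ends(1)[OF C y(1)] arc_ends(1)[OF C y(2)]] y(3) by (simp add: st_def)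
    then show "y = y'" using inj_onD[OF band_facts(3)[OF C]] y by fastforce
  qed
  show "inj_on (en C k) (K C k)"
  proof (rule inj_onI)
    fix y y' assume y: "y \<in> K C k" "y' \<in> K C k" "en C k y = en C k y'"
    then have "\<Psi> C k (y, 1) = \<Psi> C k (y', 1)"
      using inj_onD[OF triangle_map(5)[OF C] _ arc_ends(2)[OF C y(1)] arc_ends(2)[OF C y(2)]] y(3) by (simp add: en_def)
    then show "y = y'" using inj_onD[OF band_facts(3)[OF C]] y by fastforce
  qed
qed

text \<open>Sliding along the band arcs is a homotopy inside leaves, as the invariance of a
  transverse measure asks for. Parts of a band are needed too, since a distance counts only the arcs
  nearer to the vertex.\<close>

lemma holonomy:
  assumes C: "C \<in> T" and B: "B \<subseteq> K C k"
    and s: "st C k ` B \<in> meas_sets (edge C (k + 1))" "en C k ` B \<in> meas_sets (edge C (k + 2))"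
  shows "\<nu> (st C k ` B) = \<nu> (en C k ` B)"
proof -
  \<comment> \<open>Recovers the index of an arc from its start; it is continuous since
    \<open>st C k\<close> is a continuous injection of a compact set.\<close>
  define \<kappa> where "\<kappa> = the_inv_into (K C k) (st C k)"
  have \<kappa>: "\<kappa> (st C k y) = y" if "y \<in> K C k" for y
    unfolding \<kappa>_def using the_inv_into_f_f[OF st_inj(1)[OF C] that] .
  have "continuous_on (K C k) (st C k)"
    unfolding st_def[abs_def]
  proof (rule continuous_on_compose2[OF triangle_map(1)[OF C]])
    show "continuous_on (K C k) (\<lambda>y. \<Psi> C k (y, 0))"
      by (rule continuous_on_compose2[OF band_facts(2)[OF C]]) (auto intro!: continuous_intros)
  qed (use arc_in_triangle(1)[OF C] in auto)
  then have "continuous_on (st C k ` K C k) \<kappa>"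
    using continuous_on_inv[OF _ band_facts(1)[OF C]] \<kappa> by blast
  then have c\<kappa>: "continuous_on (st C k ` B) \<kappa>" using B by (blast intro: continuous_on_subset)
  define H where "H p = \<phi> C (\<Psi> C k (\<kappa> (fst p), snd p))" for p
  have "continuous_on (st C k ` B \<times> {0..1}) (\<lambda>p. (\<kappa> (fst p), snd p))"
    by (intro continuous_intros continuous_on_compose2[OF c\<kappa>]) auto
  then have "continuous_on (st C k ` B \<times> {0..1}) (\<lambda>p. \<Psi> C k (\<kappa> (fst p), snd p))"
    by (rule continuous_on_compose2[OF band_facts(2)[OF C]]) (use B \<kappa> in auto)
  then have cH: "continuous_on (st C k ` B \<times> {0..1}) H"
    unfolding H_def[abs_def]
    by (rule continuous_on_compose2[OF triangle_map(1)[OF C]]) (use B \<kappa> arc_in_triangle(1)[OF C] in auto)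
  have H1: "H (st C k y, t) = \<phi> C (\<Psi> C k (y, t))" if "y \<in> B" for y t
    using \<kappa> that B by (auto simp: H_def)
  have "\<exists>l\<in>\<L>. H ` ({x} \<times> {0..1}) \<subseteq> l" if "x \<in> st C k ` B" for x
  proof -
    obtain y where y: "y \<in> B" "x = st C k y" using \<open>x \<in> st C k ` B\<close> by auto
    then obtain l where l: "l \<in> \<L>" "\<phi> C ` \<Psi> C k ` ({y} \<times> {0..1}) \<subseteq> l"
      using band_facts(4)[OF C] B by blast
    have "H ` ({x} \<times> {0..1}) \<subseteq> l"
    proof
      fix z assume "z \<in> H ` ({x} \<times> {0..1})"
      then obtain t where "t \<in> {0..1}" "z = H (x, t)" by auto
      then have "z \<in> \<phi> C ` \<Psi> C k ` ({y} \<times> {0..1})" using H1[OF y(1), of t] y(2) by blast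
      then show "z \<in> l" using l by blast
    qed
    then show ?thesis using l by blast
  qed
  moreover have "H (x, 0) = x" if "x \<in> st C k ` B" for x using that H1[of _ 0] by (auto simp: st_def)
  moreover have "bij_betw (\<lambda>x. H (x, 1)) (st C k ` B) (en C k ` B)"
  proof -
    have "inj_on (\<lambda>x. H (x, 1)) (st C k ` B)"
    proof (rule inj_onI)
      fix x x' assume "x \<in> st C k ` B" "x' \<in> st C k ` B" "H (x, 1) = H (x', 1)"
      then obtain y y' where y: "y \<in> B" "y' \<in> B" "x = st C k y" "x' = st C k y'" "en C k y = en C k y'"
        using H1[of _ 1] by (auto simp: en_def)
      then show "x = x'" using inj_onD[OF st_inj(2)[OF C], of k y y'] B by auto
    qed
    moreover have "(\<lambda>x. H (x, 1)) ` st C k ` B = en C k ` B"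
      unfolding image_image using H1[of _ 1] by (intro image_cong) (auto simp: en_def)
    ultimately show ?thesis by (simp add: bij_betw_def)
  qed
  moreover have "st C k ` B \<subseteq> M" "en C k ` B \<subseteq> M" using st_en(3,7)[OF C] B by blast+
  moreover have "transversal (S - P) \<L> (edge C (k + 1))" "transversal (S - P) \<L> (edge C (k + 2))"
    using transv triangle_map(6)[OF C] by auto
  ultimately show ?thesis
    using s cH unfolding meas_sets_def
    by (intro conjunct2[OF transverse[unfolded transverse_measure_def], rule_format,
          of "edge C (k + 1)" "st C k ` B" "edge C (k + 2)" "en C k ` B" H] conjI ballI) blast+
qed

text \<open>\<open>enn2real\<close> turns infinite values into 0, but by \<open>nn_edge\<close>
  nothing is lost on Borel subsets of an edge, whose measure is finite.\<close>

definition nn :: "'a set \<Rightarrow> real" where "nn A = enn2real (\<nu> A)"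

lemma nn_nonneg: "0 \<le> nn A" by (simp add: nn_def)

lemma band_meas:
  assumes C: "C \<in> T"
  shows "st C k ` K C k \<in> meas_sets (edge C (k + 1))" "en C k ` K C k \<in> meas_sets (edge C (k + 2))"
    "\<nu> (st C k ` K C k) = ennreal (corner_width \<phi> \<mu> C k - d (\<phi> C (vtx k)))"
    "\<nu> (en C k ` K C k) = ennreal (corner_width \<phi> \<mu> C k - d (\<phi> C (vtx k)))"
proof -
  show a: "st C k ` K C k \<in> meas_sets (edge C (k + 1))" "en C k ` K C k \<in> meas_sets (edge C (k + 2))"
    using st_en_compact[OF C band_facts(1)[OF C]] st_en(4,8)[OF C]
    by (auto intro!: compact_meas)
  have "st C k ` K C k = \<phi> C ` \<Psi> C k ` (K C k \<times> {0})" by (auto simp: st_def)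
  then show "\<nu> (st C k ` K C k) = ennreal (corner_width \<phi> \<mu> C k - d (\<phi> C (vtx k)))"
    using width[OF C] by simp
  then show "\<nu> (en C k ` K C k) = ennreal (corner_width \<phi> \<mu> C k - d (\<phi> C (vtx k)))"
    using holonomy[OF C _ a] by simp
qed

text \<open>The two bands that end on the side \<open>j\<close> are disjoint and exhaust the support
  there; in the sum of their corner widths the measures of the other two sides cancel. Both reduced
  widths are nonnegative by \<open>deco\<close>, so \<open>ennreal\<close> is additive on
  them.\<close>

lemma edge_measure:
  assumes C: "C \<in> T"
  shows "\<nu> (edge C j) = ennreal (\<mu> (edge C j) - d (\<phi> C (vtx (j + 1))) - d (\<phi> C (vtx (j + 2))))"
    "0 \<le> \<mu> (edge C j) - d (\<phi> C (vtx (j + 1))) - d (\<phi> C (vtx (j + 2)))"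
proof -
  have m: "(j + 2 + 1) mod 3 = j mod 3" "(j + 1 + 2) mod 3 = j mod 3" by simp_all
  have "j + 1 + 1 = j + 2" by simp
  note sc = side_cong[OF m(1)] side_cong[OF m(2)] side_cong[OF mod3_shift4] this
  let ?a = "corner_width \<phi> \<mu> C (j + 2) - d (\<phi> C (vtx (j + 2)))"
  let ?b = "corner_width \<phi> \<mu> C (j + 1) - d (\<phi> C (vtx (j + 1)))"
  have nn: "0 \<le> ?a" "0 \<le> ?b" using deco[OF C] by (simp_all only: diff_ge_0_iff_ge)
  have eq: "?a + ?b = \<mu> (edge C j) - d (\<phi> C (vtx (j + 1))) - d (\<phi> C (vtx (j + 2)))"
    unfolding corner_width_def sc by (simp add: field_simps)
  let ?X = "st C (j + 2) ` K C (j + 2)" and ?Y = "en C (j + 1) ` K C (j + 1)"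
  have XY: "?X \<in> meas_sets (edge C j)" "?Y \<in> meas_sets (edge C j)"
    using band_meas(1)[OF C, of "j + 2"] band_meas(2)[OF C, of "j + 1"] unfolding sc by auto
  have "?X \<inter> ?Y = {}"
  proof -
    have False if y: "y \<in> K C (j + 2)" and y': "y' \<in> K C (j + 1)" and eq: "st C (j + 2) y = en C (j + 1) y'" for y y'
    proof -
      have "\<Psi> C (j + 2) (y, 0) \<in> side j" "\<Psi> C (j + 1) (y', 1) \<in> side j"
        using arc_ends(1)[OF C y] arc_ends(2)[OF C y'] unfolding sc by auto
      then have "\<Psi> C (j + 2) (y, 0) = \<Psi> C (j + 1) (y', 1)"
        using inj_onD[OF triangle_map(5)[OF C, of j]] eq by (simp add: st_def en_def)
      then show False
        using bands_disjoint[OF C mod3_distinct(3)[of j]] y y' by fastforce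
    qed
    then show ?thesis by blast
  qed
  then have "\<nu> (?X \<union> ?Y) = \<nu> ?X + \<nu> ?Y"
    using additiveD[OF \<nu>_measure(1)[OF triangle_map(6)[OF C]] _ XY] by blast
  moreover have "edge C j \<in> meas_sets (edge C j)" using meas_setsI[of UNIV "edge C j"] by simp
  then have "\<nu> (edge C j \<inter> M) = \<nu> (edge C j)" using \<nu>_support triangle_map(6)[OF C] by blast
  ultimately have "\<nu> (edge C j) = ennreal ?a + ennreal ?b"
    unfolding edge_support[OF C] band_meas(3,4)[OF C] by simp
  then show "\<nu> (edge C j) = ennreal (\<mu> (edge C j) - d (\<phi> C (vtx (j + 1))) - d (\<phi> C (vtx (j + 2))))"
    using nn by (simp only: eq ennreal_plus[symmetric])
  show "0 \<le> \<mu> (edge C j) - d (\<phi> C (vtx (j + 1))) - d (\<phi> C (vtx (j + 2)))"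
    using nn eq by linarith
qed

lemma nn_edge:
  assumes C: "C \<in> T"
  shows "A \<in> meas_sets (edge C j) \<Longrightarrow> \<nu> A = ennreal (nn A)"
    "A \<in> meas_sets (edge C j) \<Longrightarrow> B \<in> meas_sets (edge C j) \<Longrightarrow> A \<inter> B = {} \<Longrightarrow> nn (A \<union> B) = nn A + nn B"
    "A \<in> meas_sets (edge C j) \<Longrightarrow> B \<in> meas_sets (edge C j) \<Longrightarrow> A \<subseteq> B \<Longrightarrow> nn A \<le> nn B"
proof -
  have e: "edge C j \<in> \<Delta>" using triangle_map(6)[OF C] .
  have me: "edge C j \<in> meas_sets (edge C j)" using meas_setsI[of UNIV "edge C j"] by simp
  have fin: "\<nu> A < top" if "A \<in> meas_sets (edge C j)" for A
    using increasingD[OF \<nu>_measure(2)[OF e] meas_sets_subset[OF that] that me] edge_measure(1)[OF C, of j]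
    by (metis ennreal_less_top le_less_trans)
  show eq: "\<nu> A = ennreal (nn A)" if "A \<in> meas_sets (edge C j)" for A
    using fin[OF that] by (simp add: nn_def)
  show "nn (A \<union> B) = nn A + nn B" if "A \<in> meas_sets (edge C j)" "B \<in> meas_sets (edge C j)" "A \<inter> B = {}"
    using additiveD[OF \<nu>_measure(1)[OF e] that(3,1,2)] fin that by (simp add: nn_def enn2real_plus)
  show "nn A \<le> nn B" if "A \<in> meas_sets (edge C j)" "B \<in> meas_sets (edge C j)" "A \<subseteq> B"
    using increasingD[OF \<nu>_measure(2)[OF e] that(3,1,2)] fin that by (simp add: nn_def enn2real_mono)
qed

lemma u_meas:
  assumes C: "C \<in> T" and r: "r \<in> {0<..<1}"
  shows "u C j ` {0<..<r} \<in> meas_sets (edge C j)" "u C j ` {r<..<1} \<in> meas_sets (edge C j)"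
    "{u C j r} \<in> meas_sets (edge C j)"
    "openin (top_of_set (edge C j)) (u C j ` {0<..<r})" "openin (top_of_set (edge C j)) (u C j ` {r<..<1})"
    "edge C j = u C j ` {0<..<r} \<union> {u C j r} \<union> u C j ` {r<..<1}"
    "u C j ` {0<..<r} \<inter> u C j ` {r<..<1} = {}" "u C j r \<notin> u C j ` {0<..<r}" "u C j r \<notin> u C j ` {r<..<1}"
proof -
  note oa = open_arc_u[OF C, of j]
  have p: "continuous_on {0..1} (u C j)" and inj: "inj_on (u C j) {0<..<1}"
    and im: "u C j ` {0<..<1} = edge C j"
    using oa by (auto simp: open_arc_def path_def)
  have c: "closed (u C j ` {r..1})" "closed (u C j ` {0..r})"
    by (intro compact_imp_closed compact_continuous_image continuous_on_subset[OF p]; use r in auto)+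
  have ac: "edge C j - X \<in> meas_sets (edge C j)" "openin (top_of_set (edge C j)) (edge C j - X)"
    if "closed X" for X
    using meas_setsI[of "- X" "edge C j"] openin_open_Int[of "- X" "edge C j"] that
    by (auto simp: Diff_eq)
  show "u C j ` {0<..<r} \<in> meas_sets (edge C j)" "u C j ` {r<..<1} \<in> meas_sets (edge C j)"
    "openin (top_of_set (edge C j)) (u C j ` {0<..<r})" "openin (top_of_set (edge C j)) (u C j ` {r<..<1})"
    unfolding open_arc_image[OF oa r] using ac c by auto
  have "u C j r \<in> edge C j" using im r by blast
  then show "{u C j r} \<in> meas_sets (edge C j)" by (intro compact_meas) auto
  have "{0<..<1} = {0<..<r} \<union> {r} \<union> {r<..<1}" using r by auto
  then show "edge C j = u C j ` {0<..<r} \<union> {u C j r} \<union> u C j ` {r<..<1}"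
    using im by (metis image_Un image_empty image_insert)
  have iff: "u C j s = u C j t \<longleftrightarrow> s = t" if "s \<in> {0<..<1}" "t \<in> {0<..<1}" for s t
    using inj_onD[OF inj] that by blast
  show "u C j ` {0<..<r} \<inter> u C j ` {r<..<1} = {}" using iff r by fastforce
  have "r \<noteq> s" if "s \<in> {0<..<r} \<union> {r<..<1}" for s using that by auto
  moreover have "{0<..<r} \<union> {r<..<1} \<subseteq> {0<..<1}" using r by auto
  ultimately have "u C j r \<noteq> u C j s" if "s \<in> {0<..<r} \<union> {r<..<1}" for s
    using iff[OF r, of s] that by blast
  then show "u C j r \<notin> u C j ` {0<..<r}" "u C j r \<notin> u C j ` {r<..<1}" by blast+
qed

text \<open>The distances of \<open>p r\<close> from the two ends of an edge. Counting half of a possible atom at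
  \<open>p r\<close> on either side makes them add up to the measure of the edge.\<close>

definition lo :: "(real \<Rightarrow> 'a) \<Rightarrow> real \<Rightarrow> real" where
  "lo p r = d (p 0) + nn (p ` {0<..<r}) + nn {p r} / 2"

definition hi :: "(real \<Rightarrow> 'a) \<Rightarrow> real \<Rightarrow> real" where
  "hi p r = d (p 1) + nn (p ` {r<..<1}) + nn {p r} / 2"

text \<open>The measure of the edge falls short of \<open>\<mu>\<close> by the decorations of its
  ends, which \<open>lo\<close> and \<open>hi\<close> put back, while the two halves of the atom
  make up the point itself.\<close>

lemma lo_plus_hi:
  assumes C: "C \<in> T" and r: "r \<in> {0<..<1}"
  shows "lo (u C j) r + hi (u C j) r = \<mu> (edge C j)"
proof -
  note m = u_meas[OF C r, of j]
  have "nn (edge C j) = nn (u C j ` {0<..<r} \<union> {u C j r}) + nn (u C j ` {r<..<1})"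
  proof -
    have dj: "(u C j ` {0<..<r} \<union> {u C j r}) \<inter> u C j ` {r<..<1} = {}" using m(7,9) by blast
    show ?thesis
      using nn_edge(2)[OF C meas_sets_ops(1)[OF m(1,3)] m(2) dj] unfolding m(6)[symmetric] .
  qed
  also have "nn (u C j ` {0<..<r} \<union> {u C j r}) = nn (u C j ` {0<..<r}) + nn {u C j r}"
    by (rule nn_edge(2)[OF C m(1,3)]) (use m(8) in simp)
  finally have "nn (edge C j) = nn (u C j ` {0<..<r}) + nn {u C j r} + nn (u C j ` {r<..<1})" .
  moreover have "nn (edge C j) = \<mu> (edge C j) - d (\<phi> C (vtx (j + 1))) - d (\<phi> C (vtx (j + 2)))"
    using edge_measure[OF C, of j] by (simp add: nn_def)
  moreover have "u C j 0 = \<phi> C (vtx (j + 1))" "u C j 1 = \<phi> C (vtx (j + 2))"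
    by (simp_all add: u_def side_pt_def)
  ultimately show ?thesis by (simp add: lo_def hi_def)
qed

text \<open>The pieces of the two sides between the arc and the vertex \<open>k\<close> meet the
  support in the two ends of the same sub-band, so holonomy equates their measures, and likewise the
  atoms. For the bound, this sub-band together with the arc is part of the band, whose measure is
  the corner width less the decoration.\<close>

lemma corner_distance:
  assumes C: "C \<in> T" and y: "y \<in> K C k"
  shows "hi (u C (k + 1)) (\<rho>0 C k y) = lo (u C (k + 2)) (\<rho>1 C k y)"
    "lo (u C (k + 2)) (\<rho>1 C k y) \<le> corner_width \<phi> \<mu> C k"
proof -
  define B where "B = {y' \<in> K C k. \<rho>0 C k y < \<rho>0 C k y'}"
  have B: "B \<subseteq> K C k" "B = {y' \<in> K C k. \<rho>1 C k y' < \<rho>1 C k y}"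
    using order_same[OF C y] by (auto simp: B_def)
  note ms = u_meas[OF C st_en(2)[OF C y], of "k + 1"] and me = u_meas[OF C st_en(6)[OF C y], of "k + 2"]
  note es = triangle_map(6)[OF C, of "k + 1"] and ee = triangle_map(6)[OF C, of "k + 2"]
  have s: "u C (k + 1) ` {\<rho>0 C k y<..<1} \<inter> M = st C k ` B"
    using near_start[OF C y] by (simp add: B_def)
  have e: "u C (k + 2) ` {0<..<\<rho>1 C k y} \<inter> M = en C k ` B"
    using near_finish[OF C y] B(2) by simp
  have mB: "st C k ` B \<in> meas_sets (edge C (k + 1))" "en C k ` B \<in> meas_sets (edge C (k + 2))"
    using support_meas[OF ms(2)] support_meas[OF me(1)] s e by auto
  have n1: "nn (u C (k + 1) ` {\<rho>0 C k y<..<1}) = nn (u C (k + 2) ` {0<..<\<rho>1 C k y})"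
    using \<nu>_support[OF es ms(2)] \<nu>_support[OF ee me(1)] holonomy[OF C B(1) mB] s e by (simp add: nn_def)
  have y1: "st C k ` {y} = {u C (k + 1) (\<rho>0 C k y)}" "en C k ` {y} = {u C (k + 2) (\<rho>1 C k y)}"
    using st_en[OF C y] by auto
  have n2: "nn {u C (k + 1) (\<rho>0 C k y)} = nn {u C (k + 2) (\<rho>1 C k y)}"
    using holonomy[OF C, of "{y}" k] ms(3) me(3) y unfolding y1 nn_def by simp
  show "hi (u C (k + 1)) (\<rho>0 C k y) = lo (u C (k + 2)) (\<rho>1 C k y)"
    unfolding lo_def hi_def n1 n2 u_ends ..
  have "nn (u C (k + 2) ` {0<..<\<rho>1 C k y}) + nn {u C (k + 2) (\<rho>1 C k y)} = nn (en C k ` B) + nn (en C k ` {y})"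
    using \<nu>_support[OF ee me(1)] e y1 by (simp add: nn_def)
  also have "\<dots> = nn (en C k ` B \<union> en C k ` {y})"
  proof (rule nn_edge(2)[OF C, of _ "k + 2", symmetric])
    show "en C k ` B \<in> meas_sets (edge C (k + 2))" "en C k ` {y} \<in> meas_sets (edge C (k + 2))"
      using mB me(3) y1 by auto
    show "en C k ` B \<inter> en C k ` {y} = {}"
      using inj_onD[OF st_inj(2)[OF C, of k]] y B(1) unfolding B_def by force
  qed
  also have "\<dots> \<le> nn (en C k ` K C k)"
  proof (rule nn_edge(3)[OF C, of _ "k + 2"])
    have "en C k ` {y} \<in> meas_sets (edge C (k + 2))" unfolding y1 by (rule me(3))
    then show "en C k ` B \<union> en C k ` {y} \<in> meas_sets (edge C (k + 2))" using mB(2) meas_sets_ops(1) by blast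
  qed (use y B(1) band_meas(2)[OF C] in blast)+
  also have "\<dots> = corner_width \<phi> \<mu> C k - d (\<phi> C (vtx k))"
    using band_meas(4)[OF C, of k] deco[OF C, of k] by (simp add: nn_def)
  finally show "lo (u C (k + 2)) (\<rho>1 C k y) \<le> corner_width \<phi> \<mu> C k"
    using nn_nonneg[of "{u C (k + 2) (\<rho>1 C k y)}"] unfolding lo_def u_ends by simp
qed

section \<open>The level of a crossing point and its finite fibres\<close>

definition lev :: "(real \<Rightarrow> 'a) \<Rightarrow> real \<Rightarrow> real" where
  "lev p r = min (lo p r) (hi p r)"

lemma lev_band:
  assumes C: "C \<in> T" and y: "y \<in> K C k"
  shows "lev (u C (k + 1)) (\<rho>0 C k y) = lev (u C (k + 2)) (\<rho>1 C k y)"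
proof -
  have sc: "side (k + 1 + 2) = side k" "side (k + 2 + 1) = side k" "side (k + 1 + 1) = side (k + 2)"
    "side (k + 2 + 2) = side (k + 1)"
  proof -
    show "side (k + 1 + 2) = side k" "side (k + 2 + 1) = side k" by (rule side_cong; simp)+
    show "side (k + 1 + 1) = side (k + 2)" by simp
    show "side (k + 2 + 2) = side (k + 1)" by (rule side_cong[OF mod3_shift4])
  qed
  have t: "\<mu> (edge C k) \<le> max (\<mu> (edge C (k + 1))) (\<mu> (edge C (k + 2)))"
    "\<mu> (edge C (k + 1)) \<le> max (\<mu> (edge C (k + 2))) (\<mu> (edge C k))"
    "\<mu> (edge C (k + 2)) \<le> max (\<mu> (edge C k)) (\<mu> (edge C (k + 1)))"
    using tropical[OF C, of k] tropical[OF C, of "k + 1"] tropical[OF C, of "k + 2"] unfolding sc by auto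
  \<comment> \<open>The common distance of both ends of the arc from the vertex \<open>k\<close>,
    which is the \<open>hi\<close> end of the first side and the \<open>lo\<close> end of the
    second.\<close>
  let ?t = "lo (u C (k + 2)) (\<rho>1 C k y)"
  have "hi (u C (k + 1)) (\<rho>0 C k y) = ?t" "lo (u C (k + 1)) (\<rho>0 C k y) = \<mu> (edge C (k + 1)) - ?t"
    "hi (u C (k + 2)) (\<rho>1 C k y) = \<mu> (edge C (k + 2)) - ?t"
    using lo_plus_hi[OF C st_en(2)[OF C y], of "k + 1"] lo_plus_hi[OF C st_en(6)[OF C y], of "k + 2"]
      corner_distance(1)[OF C y] by linarith+
  then show ?thesis
    using min_tropical[OF corner_distance(2)[OF C y, unfolded corner_width_def] t] unfolding lev_def by simp
qed

text \<open>The same edge may be seen from two triangles, or twice from one. The two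
  parametrisations agree up to direction, and a reversal merely swaps \<open>lo\<close> and
  \<open>hi\<close>.\<close>

lemma lev_eq:
  assumes "C \<in> T" "C' \<in> T" "r \<in> {0<..<1}" "r' \<in> {0<..<1}" "u C j r = u C' j' r'"
  shows "lev (u C j) r = lev (u C' j') r'"
proof -
  have "u C j r \<in> edge C j" "u C' j' r' \<in> edge C' j'"
    using open_arc_u[OF assms(1), of j] open_arc_u[OF assms(2), of j'] assms(3,4)
    unfolding open_arc_def by blast+
  then have "edge C j = edge C' j'"
    using edges_disjoint[OF triangle_map(6)[OF assms(1)] triangle_map(6)[OF assms(2)]] assms(5) by metis
  then have "same_arc (u C j) (u C' j') \<or> same_arc (u C j) (\<lambda>t. u C' j' (1 - t))"
    using open_arc_unique[OF open_arc_u[OF assms(1), of j]] open_arc_u[OF assms(2), of j'] by simp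
  then show ?thesis
  proof
    assume "same_arc (u C j) (u C' j')"
    then show ?thesis using assms by (simp add: same_arc_def lev_def lo_def hi_def)
  next
    define q where "q t = u C' j' (1 - t)" for t
    assume "same_arc (u C j) (\<lambda>t. u C' j' (1 - t))"
    then have "same_arc (u C j) q" by (simp add: q_def[abs_def])
    moreover have "u C j r = q (1 - r')" "1 - r' \<in> {0<..<1}" using assms by (simp_all add: q_def)
    ultimately have *: "u C j 0 = q 0" "u C j 1 = q 1"
      "u C j ` {0<..<r} = q ` {0<..<1 - r'}" "u C j ` {r<..<1} = q ` {1 - r'<..<1}"
      using assms(3) by (simp_all add: same_arc_def)
    have "q ` {0<..<1 - r'} = u C' j' ` (\<lambda>t. 1 - t) ` {0<..<1 - r'}"
      "q ` {1 - r'<..<1} = u C' j' ` (\<lambda>t. 1 - t) ` {1 - r'<..<1}"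
      by (simp_all add: q_def[abs_def] image_image)
    moreover have "(\<lambda>t. 1 - t) ` {0<..<1 - r'} = {r'<..<1}" "(\<lambda>t. 1 - t) ` {1 - r'<..<1} = {0<..<r'}"
      by (auto intro: image_eqI[of _ _ "1 - x" for x])
    ultimately show ?thesis using * assms(5) by (simp add: lev_def lo_def hi_def q_def min.commute)
  qed
qed

text \<open>The choice is harmless by \<open>lev_eq\<close>; away from the edges the value is
  arbitrary.\<close>

definition lv :: "'a \<Rightarrow> real" where
  "lv x = (SOME v. \<exists>C\<in>T. \<exists>j. \<exists>r\<in>{0<..<1}. x = u C j r \<and> v = lev (u C j) r)"

lemma lv_u: assumes "C \<in> T" "r \<in> {0<..<1}" shows "lv (u C j r) = lev (u C j) r"
proof -
  have "\<exists>C'\<in>T. \<exists>j'. \<exists>r'\<in>{0<..<1}. u C j r = u C' j' r' \<and> lv (u C j r) = lev (u C' j') r'"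
    unfolding lv_def by (rule someI_ex) (use assms in blast)
  then show ?thesis using lev_eq assms by metis
qed

lemma finite_no_three:
  fixes X :: "real set"
  assumes "\<And>a b c. a \<in> X \<Longrightarrow> b \<in> X \<Longrightarrow> c \<in> X \<Longrightarrow> a < b \<Longrightarrow> b < c \<Longrightarrow> False"
  shows "finite X"
proof (rule ccontr)
  assume "infinite X"
  then obtain Y where Y: "Y \<subseteq> X" "finite Y" "card Y = 3" using infinite_arbitrarily_large by blast
  then obtain a b c where abc: "Y = {a, b, c}" "a \<noteq> b" "b \<noteq> c" "a \<noteq> c"
    by (auto simp: card_3_iff)
  have "a \<in> X" "b \<in> X" "c \<in> X" using abc(1) Y(1) by auto
  then show False using assms abc(2-4) by (metis linorder_neqE_linordered_idom)
qed

text \<open>For crossing points \<open>a < b < c\<close> the open piece between \<open>a\<close> and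
  \<open>c\<close> contains \<open>b\<close> and has positive measure by full support, so the
  distance at \<open>c\<close> exceeds that at \<open>a\<close>. Two crossing points can share a
  distance, for instance the atomless ends of a gap of the support; hence three points and not
  injectivity.\<close>

lemma finite_lo:
  assumes C: "C \<in> T"
  shows "finite {r \<in> {0<..<1}. u C j r \<in> M \<and> lo (u C j) r = v}"
proof (rule finite_no_three)
  fix a b c assume abc: "a \<in> {r \<in> {0<..<1}. u C j r \<in> M \<and> lo (u C j) r = v}"
    "b \<in> {r \<in> {0<..<1}. u C j r \<in> M \<and> lo (u C j) r = v}"
    "c \<in> {r \<in> {0<..<1}. u C j r \<in> M \<and> lo (u C j) r = v}" "a < b" "b < c"
  then have ra: "a \<in> {0<..<1}" and rc: "c \<in> {0<..<1}" and v: "lo (u C j) a = lo (u C j) c"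
    and bM: "u C j b \<in> M" by auto
  note ma = u_meas[OF C ra, of j] and mc = u_meas[OF C rc, of j]
  let ?V = "u C j ` {0<..<c} \<inter> u C j ` {a<..<1}"
  have V: "?V \<in> meas_sets (edge C j)" "openin (top_of_set (edge C j)) ?V"
    using meas_sets_ops(2) ma(2) mc(1) ma(5) mc(4) by blast+
  have bV: "u C j b \<in> ?V" using abc ra rc by (auto intro!: imageI)
  have ac: "u C j ` {0<..<a} \<subseteq> u C j ` {0<..<c}" "u C j a \<in> u C j ` {0<..<c}"
    using abc(4,5) ra by (auto intro!: imageI)
  have ma': "u C j ` {0<..<a} \<union> {u C j a} \<in> meas_sets (edge C j)" by (rule meas_sets_ops(1)[OF ma(1,3)])
  have "nn (u C j ` {0<..<a} \<union> {u C j a} \<union> ?V) \<le> nn (u C j ` {0<..<c})"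
    by (rule nn_edge(3)[OF C meas_sets_ops(1)[OF ma' V(1)] mc(1)]) (use ac in blast)
  moreover have "nn (u C j ` {0<..<a} \<union> {u C j a} \<union> ?V) = nn (u C j ` {0<..<a} \<union> {u C j a}) + nn ?V"
    by (rule nn_edge(2)[OF C ma' V(1)]) (use ma(7,9) in auto)
  moreover have "nn (u C j ` {0<..<a} \<union> {u C j a}) = nn (u C j ` {0<..<a}) + nn {u C j a}"
    by (rule nn_edge(2)[OF C ma(1,3)]) (use ma(8) in simp)
  ultimately have "nn ?V \<le> 0"
    using v nn_nonneg[of "{u C j a}"] nn_nonneg[of "{u C j c}"] unfolding lo_def by simp
  then have "\<nu> ?V = 0" using nn_edge(1)[OF C V(1)] by (simp add: ennreal_neg)
  then have "?V \<inter> M = {}" by (rule iffD1[OF \<nu>_measure(3)[OF triangle_map(6)[OF C] V(2)]])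
  moreover have "u C j b \<in> ?V \<inter> M" using bV bM by (rule IntI)
  ultimately show False by simp
qed

lemma finite_level_points:
  assumes C: "C \<in> T"
  shows "finite {x \<in> edge C j \<inter> M. lv x = v}"
proof -
  \<comment> \<open>Either end can be the nearer one; if it is the end at parameter 1, the distance
    from the other end is \<open>\<mu> (edge C j) - v\<close>.\<close>
  let ?X = "{r \<in> {0<..<1}. u C j r \<in> M \<and> lo (u C j) r = v} \<union>
    {r \<in> {0<..<1}. u C j r \<in> M \<and> lo (u C j) r = \<mu> (edge C j) - v}"
  have "{x \<in> edge C j \<inter> M. lv x = v} \<subseteq> u C j ` ?X"
  proof
    fix x assume x: "x \<in> {x \<in> edge C j \<inter> M. lv x = v}"
    then have "x \<in> u C j ` {0<..<1}" using open_arc_u[OF C] by (auto simp: open_arc_def)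
    then obtain r where r: "r \<in> {0<..<1}" "x = u C j r" by blast
    then have "lev (u C j) r = v" using lv_u[OF C r(1)] x by simp
    then have "lo (u C j) r = v \<or> lo (u C j) r = \<mu> (edge C j) - v"
      using lo_plus_hi[OF C r(1), of j] by (auto simp: lev_def min_def split: if_splits)
    moreover have "u C j r \<in> M" using r x by simp
    ultimately have "r \<in> ?X" using r(1) by simp
    then show "x \<in> u C j ` ?X" unfolding r(2) by (rule imageI)
  qed
  moreover have "finite (u C j ` ?X)" by (intro finite_imageI finite_UnI finite_lo[OF C])
  ultimately show ?thesis by (rule finite_subset)
qed

end

section \<open>Leaves as cyclic chains of arcs\<close>

context banded_lamination begin

definition arcs :: "('a set \<times> nat \<times> real) set" where
  "arcs = {(C, k, y). C \<in> T \<and> k < 3 \<and> y \<in> K C k}"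

definition arc_path :: "'a set \<times> nat \<times> real \<Rightarrow> real \<Rightarrow> 'a" where
  "arc_path i t = (case i of (C, k, y) \<Rightarrow> \<phi> C (\<Psi> C k (y, t)))"

lemma arcsD:
  assumes "(C, k, y) \<in> arcs"
  shows "C \<in> T" "k < 3" "y \<in> K C k"
  using assms by (auto simp: arcs_def)

lemma arc_path_simps [simp]:
  "arc_path (C, k, y) 0 = st C k y" "arc_path (C, k, y) 1 = en C k y"
  by (simp_all add: arc_path_def st_def en_def)

lemma arc_path_interior:
  assumes i: "(C, k, y) \<in> arcs" and t: "0 < t" "t < 1"
  shows "\<Psi> C k (y, t) \<in> interior model_triangle" "arc_path (C, k, y) t \<in> C"
proof -
  show a: "\<Psi> C k (y, t) \<in> interior model_triangle"
    using band_facts(5)[OF arcsD(1,3)[OF i]] t by (auto simp: corner_arc_def)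
  then show "arc_path (C, k, y) t \<in> C"
    using triangle_map(3)[OF arcsD(1)[OF i]] by (auto simp: arc_path_def)
qed

lemma triangle_subset: "C \<in> T \<Longrightarrow> C \<subseteq> S - P - \<Union>\<Delta>"
  unfolding triangles_def by (rule in_components_subset)

lemma triangles_meet: "C \<in> T \<Longrightarrow> C' \<in> T \<Longrightarrow> x \<in> C \<Longrightarrow> x \<in> C' \<Longrightarrow> C = C'"
  unfolding triangles_def using components_nonoverlap by blast

lemma arc_end:
  assumes i: "(C, k, y) \<in> arcs" and b: "b \<in> {0, 1}"
  shows "arc_path (C, k, y) b \<in> edge C (k + (if b = 0 then 1 else 2))" "arc_path (C, k, y) b \<in> M"
    "\<Psi> C k (y, b) \<in> side (k + (if b = 0 then 1 else 2))"
  using st_en[OF arcsD(1,3)[OF i]] arc_ends[OF arcsD(1,3)[OF i]] b by auto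

text \<open>Two sides of one triangle may be glued to the same edge, so the position in the surface
  does not fix the end of an arc; the side has to be given as well. On a side
  \<open>\<phi> C\<close> is injective, and the disjoint injective bands leave a single end.\<close>

lemma ends_determine:
  assumes i: "(C, k, y) \<in> arcs" and i': "(C, k', y') \<in> arcs" and bc: "b \<in> {0, 1}" "c \<in> {0, 1}"
    and eq: "arc_path (C, k, y) b = arc_path (C, k', y') c"
    and sides: "(k + (if b = 0 then 1 else 2)) mod 3 = (k' + (if c = 0 then 1 else 2)) mod 3"
  shows "k = k' \<and> y = y' \<and> b = c"
proof -
  have C: "C \<in> T" using arcsD(1)[OF i] .
  have z: "\<Psi> C k (y, b) = \<Psi> C k' (y', c)"
    using inj_onD[OF triangle_map(5)[OF C] _ arc_end(3)[OF i bc(1)]] arc_end(3)[OF i' bc(2)] eq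
    unfolding side_cong[OF sides] arc_path_def by simp
  have "b \<in> {0..1}" "c \<in> {0..1}" using bc by auto
  then have in1: "\<Psi> C k (y, b) \<in> \<Psi> C k ` (K C k \<times> {0..1})"
    and in2: "\<Psi> C k' (y', c) \<in> \<Psi> C k' ` (K C k' \<times> {0..1})"
    using arcsD(3)[OF i] arcsD(3)[OF i'] by auto
  have "k mod 3 = k' mod 3"
  proof (rule ccontr)
    assume "k mod 3 \<noteq> k' mod 3"
    from bands_disjoint[OF C this] in1 in2 z show False by auto
  qed
  then have k: "k = k'" using arcsD(2)[OF i] arcsD(2)[OF i'] by simp
  have "(y, b) = (y', c)"
    using inj_onD[OF band_facts(3)[OF C, of k], of "(y, b)" "(y', c)"] z k arcsD(3)[OF i] arcsD(3)[OF i']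
      \<open>b \<in> {0..1}\<close> \<open>c \<in> {0..1}\<close> by auto
  then show ?thesis using k by simp
qed

lemma end_exists:
  assumes C: "C \<in> T" and k: "k < 3" and x: "x \<in> edge C k" "x \<in> M"
  obtains j y b where "(C, j, y) \<in> arcs" "b \<in> {0, 1}" "arc_path (C, j, y) b = x"
    "(j + (if b = 0 then 1 else 2)) mod 3 = k"
proof -
  obtain z where z: "z \<in> side k" "x = \<phi> C z" using x(1) by blast
  have "\<phi> C z \<in> M" using z(2) x(2) by simp
  from C z(1) this show thesis
  proof (cases rule: side_band)
    case (start y)
    have "((k + 2) mod 3 + 1) mod 3 = k" using k unfolding mod_add_left_eq by simp
    moreover have "arc_path (C, (k + 2) mod 3, y) 0 = x"
      using start(2) z(2) by (simp add: arc_path_def \<Psi>_mod)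
    moreover have "(C, (k + 2) mod 3, y) \<in> arcs"
      using C start(1) by (simp add: arcs_def K_mod)
    ultimately show thesis using that[of "(k + 2) mod 3" y 0] by simp
  next
    case (finish y)
    have "((k + 1) mod 3 + 2) mod 3 = k" using k unfolding mod_add_left_eq by simp
    moreover have "arc_path (C, (k + 1) mod 3, y) 1 = x"
      using finish(2) z(2) by (simp add: arc_path_def \<Psi>_mod)
    moreover have "(C, (k + 1) mod 3, y) \<in> arcs"
      using C finish(1) by (simp add: arcs_def K_mod)
    ultimately show thesis using that[of "(k + 1) mod 3" y 1] by simp
  qed
qed

lemma two_ends:
  assumes e: "e \<in> \<Delta>" and x: "x \<in> e" "x \<in> M"
  shows "card {(j, c). j \<in> arcs \<and> c \<in> {0, 1} \<and> arc_path j c = x} = 2"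
proof -
  let ?X = "{(j, c). j \<in> arcs \<and> c \<in> {0, 1} \<and> arc_path j c = x}"
  let ?Y = "{(C, k). C \<in> T \<and> k < 3 \<and> \<phi> C ` side k = e}"
  \<comment> \<open>Sends an end to the triangle and the side on which it lies; each edge has
    exactly two such incidences.\<close>
  define f where "f = (\<lambda>((C :: 'a set, k :: nat, y :: real), b :: real). (C, (k + (if b = 0 then 1 else 2)) mod 3))"
  have "inj_on f ?X"
  proof (rule inj_onI)
    fix p q assume p: "p \<in> ?X" and q: "q \<in> ?X" and eq: "f p = f q"
    obtain C k y b where pe: "p = ((C, k, y), b)" by (metis prod.collapse)
    obtain C' k' y' b' where qe: "q = ((C', k', y'), b')" by (metis prod.collapse)
    have CC: "C' = C" and s: "(k + (if b = 0 then 1 else 2)) mod 3 = (k' + (if b' = 0 then 1 else 2)) mod 3"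
      using eq by (simp_all add: f_def pe qe)
    show "p = q"
      using ends_determine[of C k y k' y' b b'] p q s unfolding pe qe CC by auto
  qed
  moreover have "f ` ?X = ?Y"
  proof (intro equalityI subsetI)
    fix p assume "p \<in> f ` ?X"
    then obtain C k y b where i: "(C, k, y) \<in> arcs" "b \<in> {0, 1}" "arc_path (C, k, y) b = x"
      "p = (C, (k + (if b = 0 then 1 else 2)) mod 3)"
      by (auto simp: f_def)
    have "edge C (k + (if b = 0 then 1 else 2)) = e"
      using edges_disjoint[OF triangle_map(6)[OF arcsD(1)[OF i(1)]] e] arc_end(1)[OF i(1,2)] i(3) x(1) by blast
    then show "p \<in> ?Y" using i arcsD(1)[OF i(1)] by (simp add: side_mod)
  next
    fix p assume "p \<in> ?Y"
    then obtain C k where p: "p = (C, k)" "C \<in> T" "k < 3" "edge C k = e" by auto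
    obtain j y b where "(C, j, y) \<in> arcs" "b \<in> {0, 1}" "arc_path (C, j, y) b = x"
      "(j + (if b = 0 then 1 else 2)) mod 3 = k"
      using end_exists[OF p(2,3), of x] x p(4) by auto
    then have "((C, j, y), b) \<in> ?X" "f ((C, j, y), b) = p" by (simp_all add: f_def p(1))
    then show "p \<in> f ` ?X" by (rule rev_image_eqI[OF _ sym])
  qed
  ultimately have "bij_betw f ?X ?Y" by (simp add: bij_betw_def)
  then show ?thesis by (rule trans[OF bij_betw_same_card edge_two[OF e]])
qed

lemma arc_path_in_support: "i \<in> arcs \<Longrightarrow> path_image (arc_path i) \<subseteq> M"
  using arc_in_triangle(2)[OF arcsD(1,3)]
  by (cases i) (simp add: path_image_def arc_path_def image_subset_iff)

text \<open>Inner points of arcs lie in open triangles, which are disjoint and miss the edges, while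
  ends lie on edges. Within a triangle the disjoint injective bands keep the arcs apart. The level
  is preserved by \<open>lev_band\<close>.\<close>

sublocale arc_system arcs arc_path lv
proof
  fix i assume i: "i \<in> arcs"
  obtain C k y where ie: "i = (C, k, y)" by (cases i)
  note iD = arcsD[OF i[unfolded ie]]
  show "path (arc_path i)"
  proof -
    have "continuous_on {0..1} (\<lambda>t. \<Psi> C k (y, t))"
      using band_facts(5)[OF iD(1,3)] by (simp add: corner_arc_def path_def)
    then have "continuous_on {0..1} (\<lambda>t. \<phi> C (\<Psi> C k (y, t)))"
      by (rule continuous_on_compose2[OF triangle_map(1)[OF iD(1)]])
        (use arc_in_triangle(1)[OF iD(1,3)] in auto)
    then show ?thesis by (simp add: path_def ie arc_path_def[abs_def])
  qed
  have same: "i = (C, k', y') \<and> s = t"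
    if j: "(C, k', y') \<in> arcs" and s: "0 < s" "s < 1" and t: "0 < t" "t < 1"
      and eq: "arc_path i s = arc_path (C, k', y') t" for k' y' s t
  proof -
    have z: "\<Psi> C k (y, s) = \<Psi> C k' (y', t)"
      using inj_onD[OF triangle_map(2)[OF iD(1)] _ arc_path_interior(1)[OF i[unfolded ie] s]
          arc_path_interior(1)[OF j t]] eq by (simp add: ie arc_path_def)
    have "\<Psi> C k (y, s) \<in> \<Psi> C k ` (K C k \<times> {0..1})" "\<Psi> C k' (y', t) \<in> \<Psi> C k' ` (K C k' \<times> {0..1})"
      using iD(3) arcsD(3)[OF j] s t by auto
    then have "k mod 3 = k' mod 3" using bands_disjoint[OF iD(1), of k k'] z by auto
    then have k: "k = k'" using iD(2) arcsD(2)[OF j] by simp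
    have "(y, s) = (y', t)"
      using inj_onD[OF band_facts(3)[OF iD(1), of k], of "(y, s)" "(y', t)"] z k iD(3) arcsD(3)[OF j] s t
      by auto
    then show ?thesis using k ie by simp
  qed
  show "inj_on (arc_path i) {0<..<1}"
    by (rule inj_onI) (use same[of k y] i ie in auto)
  show "arc_path i s \<noteq> arc_path j t"
    if j: "j \<in> arcs" and ne: "i \<noteq> j" and st: "0 < s" "s < 1" "0 < t" "t < 1" for j s t
  proof
    assume eq: "arc_path i s = arc_path j t"
    obtain C' k' y' where je: "j = (C', k', y')" by (cases j)
    have "C = C'"
      using triangles_meet[OF iD(1) arcsD(1)[OF j[unfolded je]]] arc_path_interior(2)[OF i[unfolded ie] st(1,2)]
        arc_path_interior(2)[OF j[unfolded je] st(3,4)] eq by (simp add: ie je)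
    then show False using same[of k' y' s t] j ne st eq je by auto
  qed
  show "arc_path i t \<noteq> arc_path j b"
    if j: "j \<in> arcs" and b: "b \<in> {0, 1}" and t: "0 < t" "t < 1" for j b t
  proof
    assume eq: "arc_path i t = arc_path j b"
    obtain C' k' y' where je: "j = (C', k', y')" by (cases j)
    have "arc_path j b \<in> \<Union>\<Delta>"
      using arc_end(1)[OF j[unfolded je] b] triangle_map(6)[OF arcsD(1)[OF j[unfolded je]]]
      unfolding je by blast
    moreover have "arc_path i t \<in> C" using arc_path_interior(2)[OF i[unfolded ie] t] ie by simp
    ultimately show False using triangle_subset[OF iD(1)] eq by auto
  qed
  show "card {(j, c). j \<in> arcs \<and> c \<in> {0, 1} \<and> arc_path j c = arc_path i b} = 2" if b: "b \<in> {0, 1}" for b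
    using two_ends[OF triangle_map(6)[OF iD(1)] arc_end(1)[OF i[unfolded ie] b] arc_end(2)[OF i[unfolded ie] b]]
    by (simp add: ie)
  show "lv (arc_path i 1) = lv (arc_path i 0)"
    using lev_band[OF iD(1,3)] lv_u[OF iD(1) st_en(2)[OF iD(1,3)], of "k + 1"]
      lv_u[OF iD(1) st_en(6)[OF iD(1,3)], of "k + 2"] st_en(1,5)[OF iD(1,3)] by (simp add: ie)
next
  fix v
  \<comment> \<open>An arc is determined by its triangle, its corner and its start, and the starts
    at a given level are finitely many points of an edge.\<close>
  let ?A = "\<lambda>C k. {y \<in> K C k. lv (st C k y) = v}"
  have "finite (?A C k)" if C: "C \<in> T" for C k
  proof -
    have "st C k ` ?A C k \<subseteq> {x \<in> edge C (k + 1) \<inter> M. lv x = v}"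
      using st_en(3,4)[OF C] by auto
    then have "finite (st C k ` ?A C k)" using finite_level_points[OF C] finite_subset by blast
    then show ?thesis using inj_on_subset[OF st_inj(1)[OF C]] by (metis (no_types, lifting) finite_imageD mem_Collect_eq subsetI)
  qed
  then have "finite (SIGMA C:T. SIGMA k:{..<3}. ?A C k)"
    using finite_triangles[OF triangulation] by (intro finite_SigmaI) auto
  moreover have "{i \<in> arcs. lv (arc_path i 0) = v} \<subseteq> (SIGMA C:T. SIGMA k:{..<3}. ?A C k)"
    by (auto simp: arcs_def)
  ultimately show "finite {i \<in> arcs. lv (arc_path i 0) = v}" using finite_subset by blast
qed

text \<open>A point of the support is no puncture, so it lies on an edge, which is a side of some
  triangle, or in an open triangle; \<open>support\<close> then puts it on a band arc.\<close>

lemma support_arcs: "M = (\<Union>i\<in>arcs. path_image (arc_path i))"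
proof
  show "(\<Union>i\<in>arcs. path_image (arc_path i)) \<subseteq> M" using arc_path_in_support by (rule UN_least)
  have *: "\<phi> C z \<in> (\<Union>i\<in>arcs. path_image (arc_path i))"
    if C: "C \<in> T" and z: "z \<in> model_triangle - vtx ` {..<3}" "\<phi> C z \<in> M" for C z
  proof -
    have "z \<in> {z \<in> model_triangle - vtx ` {..<3}. \<phi> C z \<in> \<Union>\<L>}" using z by simp
    then have "z \<in> (\<Union>k<3. \<Psi> C k ` (K C k \<times> {0..1}))" unfolding support[OF C] .
    then obtain k y t where k: "k < 3" "y \<in> K C k" "t \<in> {0..1}" "z = \<Psi> C k (y, t)" by auto
    then have "(C, k, y) \<in> arcs" using C by (simp add: arcs_def)
    moreover have "\<phi> C z \<in> path_image (arc_path (C, k, y))"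
      unfolding path_image_def arc_path_def using k(3,4) by auto
    ultimately show ?thesis by (rule UN_I)
  qed
  show "M \<subseteq> (\<Union>i\<in>arcs. path_image (arc_path i))"
  proof
    fix x assume x: "x \<in> M"
    then have xS: "x \<in> S - P" using support_subset by (rule rev_subsetD)
    show "x \<in> (\<Union>i\<in>arcs. path_image (arc_path i))"
    proof (cases "x \<in> \<Union>\<Delta>")
      case True
      then obtain e where e: "e \<in> \<Delta>" "x \<in> e" by blast
      then have "{(C, k). C \<in> T \<and> k < 3 \<and> \<phi> C ` side k = e} \<noteq> {}"
        using edge_two[OF e(1)] by (metis (no_types, lifting) card.empty zero_neq_numeral)
      then obtain C k where C: "C \<in> T" "edge C k = e" by auto
      then obtain z where z: "z \<in> side k" "x = \<phi> C z" using e(2) by blast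
      have "z \<in> model_triangle - vtx ` {..<3}" using side_subset z(1) by (rule subsetD)
      then show ?thesis using *[OF C(1)] z(2) x by simp
    next
      case False
      then have "x \<in> \<Union>T" using xS unfolding triangles_def Union_components by blast
      then obtain C where C: "C \<in> T" "x \<in> C" by blast
      then obtain z where z: "z \<in> interior model_triangle" "x = \<phi> C z"
        using triangle_map(3)[OF C(1)] by blast
      have "z \<notin> vtx ` {..<3}"
      proof
        assume "z \<in> vtx ` {..<3}"
        then have "x \<in> P" using z(2) triangle_map(4)[OF C(1)] by auto
        then show False using xS by simp
      qed
      then show ?thesis using *[OF C(1), of z] z x interior_subset by auto
    qed
  qed
qed

text \<open>In a flow box around a crossing point the height is injective on the edge and takes
  countably many values on the leaf. Finitely many boxes suffice because the edge meets the support
  in a compact set.\<close>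

lemma leaf_edge_countable:
  assumes C: "C \<in> T" and l: "l \<in> \<L>"
  shows "countable (l \<inter> edge C j)"
proof -
  have "compact (st C (j + 2) ` K C (j + 2) \<union> en C (j + 1) ` K C (j + 1))"
    using st_en_compact[OF C band_facts(1)[OF C]] by (intro compact_Un) auto
  then have cpt: "compact (edge C j \<inter> M)" unfolding edge_support[OF C] .
  have tr: "transversal (S - P) \<L> (edge C j)" using transv triangle_map(6)[OF C] by blast
  have "\<exists>W. open W \<and> x \<in> W \<and> countable (l \<inter> edge C j \<inter> W)" if x: "x \<in> edge C j \<inter> M" for x
  proof -
    obtain U f where U: "flow_box (S - P) \<L> U f" "x \<in> U" "inj_on (snd \<circ> f) (edge C j \<inter> U)"
      using tr x unfolding transversal_def by blast
    obtain W where W: "open W" "U = (S - P) \<inter> W"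
      using U(1) unfolding flow_box_def openin_open by blast
    have "countable ((snd \<circ> f) ` (l \<inter> U))" using U(1) l unfolding flow_box_def by blast
    then have "countable ((snd \<circ> f) ` (l \<inter> edge C j \<inter> U))"
      by (rule countable_subset[rotated]) blast
    then have "countable (l \<inter> edge C j \<inter> U)"
      by (rule countable_image_inj_on) (rule inj_on_subset[OF U(3)], blast)
    moreover have "l \<inter> edge C j \<inter> W = l \<inter> edge C j \<inter> U"
      using edge_subset[OF triangle_map(6)[OF C, of j]] W(2) by blast
    ultimately show ?thesis using W U(2) by auto
  qed
  then obtain W where W: "\<And>x. x \<in> edge C j \<inter> M \<Longrightarrow> open (W x) \<and> x \<in> W x \<and> countable (l \<inter> edge C j \<inter> W x)"
    by metis
  obtain D where D: "D \<subseteq> edge C j \<inter> M" "finite D" "edge C j \<inter> M \<subseteq> (\<Union>x\<in>D. W x)"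
    using compactE_image[OF cpt, of "edge C j \<inter> M" W] W by (metis UN_I subsetI)
  have "l \<inter> edge C j \<subseteq> (\<Union>x\<in>D. l \<inter> edge C j \<inter> W x)" using D(3) l by blast
  moreover have "countable (l \<inter> edge C j \<inter> W x)" if "x \<in> D" for x
    using W[OF subsetD[OF D(1) that]] by simp
  then have "countable (\<Union>x\<in>D. l \<inter> edge C j \<inter> W x)"
    by (rule countable_UN[OF countable_finite[OF D(2)]])
  ultimately show ?thesis by (rule countable_subset)
qed

theorem leaf_closed: assumes l: "l \<in> \<L>" shows "simple_closed_curve l"
proof (rule leaf_simple_closed_curve[of \<L>])
  have lam: "lamination (S - P) \<L>" using measured by (simp add: measured_lamination_def)
  then show "pairwise disjnt \<L>" "path_connected l" "l \<noteq> {}"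
    using l unfolding lamination_def by blast+
  show "\<Union>\<L> = (\<Union>i\<in>arcs. path_image (arc_path i))" by (rule support_arcs)
  show "\<exists>l\<in>\<L>. path_image (arc_path i) \<subseteq> l" if i: "i \<in> arcs" for i
  proof -
    obtain C k y where ie: "i = (C, k, y)" by (cases i)
    have "path_image (arc_path i) = \<phi> C ` \<Psi> C k ` ({y} \<times> {0..1})"
      by (auto simp: path_image_def arc_path_def ie)
    then show ?thesis using band_facts(4) arcsD(1,3)[OF i[unfolded ie]] by metis
  qed
  show "countable {i \<in> arcs. path_image (arc_path i) \<subseteq> l}"
  proof -
    let ?A = "\<lambda>C k. {y \<in> K C k. st C k y \<in> l}"
    have "countable (?A C k)" if C: "C \<in> T" for C k
    proof -
      have "st C k ` ?A C k \<subseteq> l \<inter> edge C (k + 1)" using st_en(4)[OF C] by auto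
      then have "countable (st C k ` ?A C k)" using leaf_edge_countable[OF C l] countable_subset by blast
      then show ?thesis by (rule countable_image_inj_on) (rule inj_on_subset[OF st_inj(1)[OF C]], blast)
    qed
    then have "countable (SIGMA C:T. SIGMA k:{..<3}. ?A C k)"
      using finite_triangles[OF triangulation] by (intro countable_SIGMA) (auto intro: countable_finite)
    moreover have "st C k y \<in> path_image (arc_path (C, k, y))" for C k y
      using pathstart_in_path_image[of "arc_path (C, k, y)"] by (simp add: pathstart_def)
    then have "{i \<in> arcs. path_image (arc_path i) \<subseteq> l} \<subseteq> (SIGMA C:T. SIGMA k:{..<3}. ?A C k)"
      by (auto simp: arcs_def)
    ultimately show ?thesis by (rule countable_subset[rotated])
  qed
qed (rule l)

end

theorem lemma2p3:
  fixes S P :: "'a::t2_space set"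
    and \<A> :: "('a set \<times> ('a \<Rightarrow> complex)) set"
    and g s :: nat
    and \<Delta> :: "'a set set"
    and \<phi> :: "'a set \<Rightarrow> complex \<Rightarrow> 'a"
    and \<mu> :: "'a set \<Rightarrow> real"
    and \<L> :: "'a set set"
    and \<nu> :: "'a set \<Rightarrow> ennreal"
    and d :: "'a \<Rightarrow> real"
  assumes "punctured_surface S \<A> P g s"
    and "ideal_triangulation S P \<Delta> \<phi>"
    and "represents_c_M S P \<Delta> \<phi> \<mu> \<L> \<nu> d"
    and "tropical_triangle_inequalities S P \<Delta> \<phi> \<mu>"
  shows "\<forall>l\<in>\<L>. simple_closed_curve l"
proof
  fix l assume l: "l \<in> \<L>"
  note tri = assms(2) and rep = assms(3)[unfolded represents_c_M_def] and trop = assms(4)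
  let ?T = "triangles S P \<Delta>"
  define good where "good C K \<Psi> \<longleftrightarrow>
       (\<forall>k<3. corner_band \<L> (\<phi> C) k (K k) (\<Psi> k) \<and>
           \<nu> (\<phi> C ` \<Psi> k ` (K k \<times> {0})) =
             ennreal (corner_width \<phi> \<mu> C k - d (\<phi> C (vtx k)))) \<and>
        disjoint_family_on (\<lambda>k. \<Psi> k ` (K k \<times> {0..1})) {..<3} \<and>
        {z \<in> model_triangle - vtx ` {..<3}. \<phi> C z \<in> \<Union>\<L>} = (\<Union>k<3. \<Psi> k ` (K k \<times> {0..1}))"
    for C and K :: "nat \<Rightarrow> real set" and \<Psi> :: "nat \<Rightarrow> real \<times> real \<Rightarrow> complex"
  have "\<forall>C\<in>?T. \<exists>K \<Psi>. good C K \<Psi>" using rep unfolding good_def by simp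
  then obtain K \<Psi> where good: "\<And>C. C \<in> ?T \<Longrightarrow> good C (K C) (\<Psi> C)" by metis
  have vm: "vtx (k mod 3) = vtx k" and sm: "side (k mod 3) = side k" for k
    by (rule vtx_mod, rule side_mod)
  have sm1: "side (k mod 3 + n) = side (k + n)" for k n by (rule side_cong) (rule mod_add_left_eq)
  have cb: "corner_band \<L> \<psi> (k mod 3) A B \<longleftrightarrow> corner_band \<L> \<psi> k A B" for \<psi> k A B
    unfolding corner_band_def sm1 ..
  have cw: "corner_width \<phi> \<mu> C (k mod 3) = corner_width \<phi> \<mu> C k" for C k
    unfolding corner_width_def sm1 sm ..
  \<comment> \<open>The decoration is the minimum of a finite set of corner widths containing this
    one; the index is reduced modulo 3 to find it there.\<close>
  have deco: "d (\<phi> C (vtx k)) \<le> corner_width \<phi> \<mu> C k" if C: "C \<in> ?T" for C k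
  proof -
    let ?X = "{corner_width \<phi> \<mu> C' j | C' j. C' \<in> ?T \<and> j < 3 \<and> \<phi> C' (vtx j) = \<phi> C (vtx k)}"
    have "?X \<subseteq> (\<lambda>(C, j). corner_width \<phi> \<mu> C j) ` (?T \<times> {..<3})" by auto
    moreover have "finite ((\<lambda>(C, j). corner_width \<phi> \<mu> C j) ` (?T \<times> {..<3}))"
      using finite_triangles[OF tri] by simp
    ultimately have fin: "finite ?X" by (rule finite_subset)
    have mem: "corner_width \<phi> \<mu> C (k mod 3) \<in> ?X"
      using C vm[of k] by (intro CollectI exI[of _ C] exI[of _ "k mod 3"]) auto
    have "\<forall>C\<in>?T. \<forall>j<3. \<phi> C (vtx j) \<in> P" using tri unfolding ideal_triangulation_def by simp
    then have "\<phi> C (vtx (k mod 3)) \<in> P" using C by simp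
    then have "\<phi> C (vtx k) \<in> P" unfolding vm .
    then have "d (\<phi> C (vtx k)) = Min ?X"
      by (rule rep[THEN conjunct2, THEN conjunct2, THEN conjunct1, rule_format, unfolded decoration_def])
    then show ?thesis using Min_le[OF fin mem] unfolding cw by simp
  qed
  \<comment> \<open>The bands given for the corners 0, 1, 2 are extended periodically to all natural
    indices.\<close>
  interpret banded_lamination S P \<Delta> \<phi> \<mu> \<L> \<nu> d "\<lambda>C k. K C (k mod 3)" "\<lambda>C k. \<Psi> C (k mod 3)"
  proof
    fix C k assume C: "C \<in> ?T"
    note g = good[OF C, unfolded good_def]
    show "d (\<phi> C (vtx k)) \<le> corner_width \<phi> \<mu> C k" by (rule deco[OF C])
    have k: "k mod 3 < 3" by simp
    show "corner_band \<L> (\<phi> C) k (K C (k mod 3)) (\<Psi> C (k mod 3))" using g k unfolding cb[symmetric, of _ k] by blast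
    show "\<nu> (\<phi> C ` \<Psi> C (k mod 3) ` (K C (k mod 3) \<times> {0})) = ennreal (corner_width \<phi> \<mu> C k - d (\<phi> C (vtx k)))"
      using g k cw[of C k] vm[of k] by metis
    show "\<mu> (\<phi> C ` side k) \<le> max (\<mu> (\<phi> C ` side (k + 1))) (\<mu> (\<phi> C ` side (k + 2)))"
    proof -
      have t: "\<mu> (\<phi> C ` side 0) \<le> max (\<mu> (\<phi> C ` side 1)) (\<mu> (\<phi> C ` side 2))"
        "\<mu> (\<phi> C ` side 1) \<le> max (\<mu> (\<phi> C ` side 0)) (\<mu> (\<phi> C ` side 2))"
        "\<mu> (\<phi> C ` side 2) \<le> max (\<mu> (\<phi> C ` side 0)) (\<mu> (\<phi> C ` side 1))"
        using trop C unfolding tropical_triangle_inequalities_def Let_def by auto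
      have 34: "side 3 = side 0" "side 4 = side 1" by (rule side_cong; simp)+
      have n: "(0::nat) + 1 = 1" "(0::nat) + 2 = 2" "(1::nat) + 1 = 2" "(1::nat) + 2 = 3"
        "(2::nat) + 1 = 3" "(2::nat) + 2 = 4" by simp_all
      have s: "side k = side (k mod 3)" "side (k + 1) = side (k mod 3 + 1)" "side (k + 2) = side (k mod 3 + 2)"
        by (rule sm[symmetric] sm1[symmetric])+
      show ?thesis
      proof (cases k rule: mod3_cases)
        case 1
        show ?thesis unfolding s 1 n by (rule t(1))
      next
        case 2
        show ?thesis unfolding s 2 n 34 max.commute[of "\<mu> (\<phi> C ` side 2)"] by (rule t(2))
      next
        case 3
        show ?thesis unfolding s 3 n 34 by (rule t(3))
      qed
    qed
    show "\<Psi> C (j mod 3) ` (K C (j mod 3) \<times> {0..1}) \<inter> \<Psi> C (k mod 3) ` (K C (k mod 3) \<times> {0..1}) = {}"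
      if "j mod 3 \<noteq> k mod 3" for j
      using g that by (simp add: disjoint_family_on_def)
    show "{z \<in> model_triangle - vtx ` {..<3}. \<phi> C z \<in> \<Union>\<L>} = (\<Union>k<3. \<Psi> C (k mod 3) ` (K C (k mod 3) \<times> {0..1}))"
      using g by simp
  qed (use tri rep in auto)
  show "simple_closed_curve l" using leaf_closed[OF l] .
qed

end
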